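(* Let $n,m\ge 1$ and $d\ge 1$ be integers and let $f,g_1,\dots,g_m\in\mathbb{R}_d[x]$, $x=(x_1,\dots,x_n)$. Write $g:=(g_1,\dots,g_m)$. Assume that $f$ is non-negative on $S(g)$ and that $f(C(g)\cap S(g))$ is finite. Set $$w:=d\cdot\big(c(n+m+1,\,d+1,\,n+2m+1)-1\big).$$ Let $\bar\lambda:=(\lambda_0,\dots,\lambda_m)$ be a vector of $m+1$ further variables and $$h_{\mathrm{FJ}}:=\Big(\lambda_0\nabla f-\sum_{j=1}^m \lambda_j \nabla g_j,\ \lambda_1g_1,\dots,\lambda_mg_m,\ 1-\sum_{j=0}^m\lambda_j^2\Big).$$ Then there exists $q\in \Sigma_w^2[x,\bar \lambda]$ such that $f-q$ vanishes on $(S(g)\times\mathbb{R}^{m+1})\cap V(h_{\mathrm{FJ}})$.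
   Context: Notation. $\mathbb{R}_d[x]$ is the space of real polynomials in $x$ of degree at most $d$. $S(g):=\{x\in\mathbb{R}^n: g_j(x)\ge 0,\ j=1,\dots,m\}$. For a tuple $h$ of polynomials, $V(h)$ is its set of common real zeros; $\nabla p=(\partial p/\partial x_1,\dots,\partial p/\partial x_n)$, so $h_{\mathrm{FJ}}$ consists of $n+m+1$ polynomials in $\mathbb{R}[x,\bar\lambda]$ and $V(h_{\mathrm{FJ}})\subset\mathbb{R}^{n+m+1}$. Polynomials in $x$ are also regarded as polynomials in $(x,\bar\lambda)$. Critical points: let $\varphi^g(x)\in\mathbb{R}^{(n+m)\times m}$ be the matrix whose $j$-th column is $\nabla g_j(x)$ stacked on top of $g_j(x)e_j$ ($e_j$ the $j$-th standard basis vector of $\mathbb{R}^m$). Then $C(g):=\{x\in\mathbb{R}^n:\operatorname{rank}(\varphi^g(x))<m\}$. $\Sigma^2_w[x,\bar\lambda]$ is the cone of sums of squares of polynomials in $\mathbb{R}[x,\bar\lambda]$ of degree at most $w$. For $n,d,s\in\mathbb{N}$, $c(n,d,s):=d(2d-1)^{n+s-1}$. *)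

theory Defs
  imports "HOL-Analysis.Analysis" "HOL-Library.Poly_Mapping"
begin

text \<open>A real polynomial in variables indexed by \<open>'v\<close> is a finitely supported map from exponent vectors to coefficients;
  the ring operations are those of \<^theory>\<open>HOL-Library.Poly_Mapping\<close>.\<close>

type_synonym 'v mpoly = "('v \<Rightarrow>\<^sub>0 nat) \<Rightarrow>\<^sub>0 real"

definition mpoly_var :: "'v \<Rightarrow> 'v mpoly" where
  "mpoly_var v = Poly_Mapping.single (Poly_Mapping.single v 1) 1"

definition monom_eval :: "('v \<Rightarrow>\<^sub>0 nat) \<Rightarrow> real^'v \<Rightarrow> real" where
  "monom_eval a x = (\<Prod>v\<in>UNIV. (x $ v) ^ Poly_Mapping.lookup a v)"

definition mpoly_eval :: "'v mpoly \<Rightarrow> real^'v \<Rightarrow> real" where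
  "mpoly_eval p x = (\<Sum>a\<in>Poly_Mapping.keys p. Poly_Mapping.lookup p a * monom_eval a x)"

text \<open>Stated by support so that the zero polynomial is included.\<close>

definition mpolys_upto :: "nat \<Rightarrow> 'v::finite mpoly set" where
  "mpolys_upto d = {p. \<forall>a\<in>Poly_Mapping.keys p. (\<Sum>v\<in>UNIV. Poly_Mapping.lookup a v) \<le> d}"

text \<open>The formal partial derivative. If \<open>v\<close> does not occur in the exponent \<open>a\<close>, the truncated
  subtraction is harmless because the coefficient is zero.\<close>

definition mpoly_pderiv :: "'v \<Rightarrow> 'v mpoly \<Rightarrow> 'v mpoly" where
  "mpoly_pderiv v p = (\<Sum>a\<in>Poly_Mapping.keys p.
     Poly_Mapping.single (a - Poly_Mapping.single v 1)
       (Poly_Mapping.lookup p a * real (Poly_Mapping.lookup a v)))"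

definition extend_exponent :: "('n \<Rightarrow>\<^sub>0 nat) \<Rightarrow> ('n + 'k \<Rightarrow>\<^sub>0 nat)" where
  "extend_exponent a =
     (\<Sum>i\<in>Poly_Mapping.keys a. Poly_Mapping.single (Inl i) (Poly_Mapping.lookup a i))"

definition extend_mpoly :: "'n mpoly \<Rightarrow> ('n + 'k) mpoly" where
  "extend_mpoly p =
     (\<Sum>a\<in>Poly_Mapping.keys p. Poly_Mapping.single (extend_exponent a) (Poly_Mapping.lookup p a))"

definition join_vec :: "real^'n \<Rightarrow> real^'k \<Rightarrow> real^('n + 'k)" where
  "join_vec x l = (\<chi> v. case v of Inl i \<Rightarrow> x $ i | Inr k \<Rightarrow> l $ k)"

text \<open>The bound \<open>w\<close> restricts the degree of the polynomials that are squared,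
  not the degree of the sum.\<close>

definition sos_upto :: "nat \<Rightarrow> 'v::finite mpoly set" where
  "sos_upto w = {(\<Sum>p\<leftarrow>ps. p\<^sup>2) | ps. set ps \<subseteq> mpolys_upto w}"

definition basic_closed_set :: "('m \<Rightarrow> 'n mpoly) \<Rightarrow> (real^'n) set" where
  "basic_closed_set g = {x. \<forall>j. mpoly_eval (g j) x \<ge> 0}"

definition real_zeros :: "('i \<Rightarrow> 'v mpoly) \<Rightarrow> (real^'v) set" where
  "real_zeros h = {x. \<forall>i. mpoly_eval (h i) x = 0}"

definition critical_matrix :: "('m \<Rightarrow> 'n mpoly) \<Rightarrow> real^'n \<Rightarrow> real^'m^('n + 'm)" where
  "critical_matrix g x = (\<chi> r j. case r of
      Inl i \<Rightarrow> mpoly_eval (mpoly_pderiv i (g j)) x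
    | Inr k \<Rightarrow> if k = j then mpoly_eval (g j) x else 0)"

definition critical_points :: "('m::finite \<Rightarrow> 'n::finite mpoly) \<Rightarrow> (real^'n) set" where
  "critical_points g = {x. rank (critical_matrix g x) < CARD('m)}"

text \<open>The multipliers are indexed by \<open>'m option\<close>: \<open>None\<close> stands for the index \<open>0\<close> and \<open>Some j\<close>
  for the index of \<open>g j\<close>. The system is indexed by \<open>'n + 'm + unit\<close>, following
  its three blocks.\<close>

definition lam :: "'m option \<Rightarrow> ('n + 'm option) mpoly" where
  "lam k = mpoly_var (Inr k)"

definition h_FJ :: "'n mpoly \<Rightarrow> ('m::finite \<Rightarrow> 'n mpoly) \<Rightarrow>
    'n + 'm + unit \<Rightarrow> ('n + 'm option) mpoly" where
  "h_FJ f g r = (case r of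
      Inl i \<Rightarrow> lam None * extend_mpoly (mpoly_pderiv i f)
               - (\<Sum>j\<in>UNIV. lam (Some j) * extend_mpoly (mpoly_pderiv i (g j)))
    | Inr (Inl j) \<Rightarrow> lam (Some j) * extend_mpoly (g j)
    | Inr (Inr _) \<Rightarrow> 1 - (\<Sum>k\<in>UNIV. (lam k)\<^sup>2))"

definition c_bound :: "nat \<Rightarrow> nat \<Rightarrow> nat \<Rightarrow> nat" where
  "c_bound n d s = d * (2 * d - 1) ^ (n + s - 1)"

end

theory Submission
  imports Defs
begin

text \<open>
  Let \<open>V\<close> be the set of values of \<open>f\<close> at the points \<open>x\<close> of the feasible set that admit Fritz John
  multipliers. If \<open>V\<close> is finite with at most \<open>c\<close> elements, there is a polynomial \<open>p\<close> in one variable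
  of degree at most \<open>c - 1\<close> with \<open>p t = sqrt t\<close> on \<open>V\<close>, because \<open>f\<close> is nonnegative on the feasible set.
  Then \<open>q = (p \<circ> f)\<^sup>2\<close> is a single square of a polynomial of degree at most \<open>d * (c - 1)\<close>, and it agrees
  with \<open>f\<close> on the whole variety. So everything rests on bounding the number of elements of \<open>V\<close>, which
  is done in two independent steps.

  The first step shows that \<open>V\<close> is countable (\<open>countable_FJ_values\<close>). Suppose \<open>f x\<close> is transcendental over
  the countable ring generated by the coefficients of \<open>f\<close> and the \<open>g\<^sub>j\<close>. There is a derivation of the
  field \<open>\<real>\<close> that kills this ring and takes the value \<open>1\<close> at \<open>f x\<close> (\<open>derivation_exists\<close>). Applied to \<open>f x\<close>
  and to those \<open>g\<^sub>j x\<close> that have a nonzero multiplier, it turns the gradient equation into \<open>\<lambda>\<^sub>0 = 0\<close>, so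
  that \<open>x\<close> is a critical point of \<open>g\<close>. Such points contribute only finitely many values by assumption,
  and only countably many reals are algebraic over a countable ring.

  The second step improves countability to an explicit bound (\<open>card_values_on_zero_set_le\<close>). With
  slack variables, \<open>V\<close> becomes the set of values of a polynomial \<open>F\<close> on the zeros of a sum of squares
  \<open>Q\<close>. Since a countable set contains no interval, any finitely many values can be separated by levels
  that \<open>F\<close> does not attain on the zeros of \<open>Q\<close>. Between these levels, a small perturbation of \<open>Q\<close> by pure
  powers of the variables has local minima, one for each value. The pure powers dominate in degree,
  so the critical equations allow every monomial to be reduced to one with bounded exponents, and
  counting these monomials bounds the number of critical points
  (\<open>card_le_if_pure_powers_reducible\<close>). The bound \<open>c\<close> in the statement is at least this count
  (\<open>perturbation_bound_le_c_bound\<close>).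
\<close>

section \<open>Evaluation, degree and derivatives of polynomials\<close>

lemma mpoly_eval_superset:
  assumes "finite A" "Poly_Mapping.keys p \<subseteq> A"
  shows "mpoly_eval p x = (\<Sum>a\<in>A. Poly_Mapping.lookup p a * monom_eval a x)"
  unfolding mpoly_eval_def
  by (rule sum.mono_neutral_left) (use assms in \<open>auto simp: in_keys_iff\<close>)

lemma mpoly_eval_zero [simp]: "mpoly_eval 0 x = 0"
  by (simp add: mpoly_eval_def)

lemma mpoly_eval_add [simp]: "mpoly_eval (p + q) x = mpoly_eval p x + mpoly_eval q x"
proof -
  let ?A = "Poly_Mapping.keys p \<union> Poly_Mapping.keys q"
  have "Poly_Mapping.keys (p + q) \<subseteq> ?A"
    by (rule Poly_Mapping.keys_add)
  then show ?thesis
    by (simp add: mpoly_eval_superset[of ?A] lookup_add distrib_right sum.distrib)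
qed

lemma mpoly_eval_uminus [simp]: "mpoly_eval (- p) x = - mpoly_eval p x"
  using mpoly_eval_add[of p "- p" x] by simp

lemma mpoly_eval_diff [simp]: "mpoly_eval (p - q) x = mpoly_eval p x - mpoly_eval q x"
  using mpoly_eval_add[of p "- q" x] by simp

lemma mpoly_eval_sum [simp]: "mpoly_eval (\<Sum>i\<in>I. p i) x = (\<Sum>i\<in>I. mpoly_eval (p i) x)"
  by (induction I rule: infinite_finite_induct) auto

lemma mpoly_eval_single [simp]: "mpoly_eval (Poly_Mapping.single a c) x = c * monom_eval a x"
  by (simp add: mpoly_eval_def)

lemma monom_eval_zero [simp]: "monom_eval 0 x = 1"
  by (simp add: monom_eval_def)

lemma monom_eval_add: "monom_eval (a + b) x = monom_eval a x * monom_eval b x"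
  by (simp add: monom_eval_def lookup_add power_add prod.distrib)

lemma monom_eval_single [simp]: "monom_eval (Poly_Mapping.single v k) x = (x $ v) ^ k"
proof -
  have "monom_eval (Poly_Mapping.single v k) x = (\<Prod>u\<in>UNIV. if u = v then (x $ v) ^ k else 1)"
    unfolding monom_eval_def by (rule prod.cong) (auto simp: lookup_single when_def)
  then show ?thesis by simp
qed

lemma mpoly_eq_sum_single:
  "p = (\<Sum>a\<in>Poly_Mapping.keys p. Poly_Mapping.single a (Poly_Mapping.lookup p a))"
  by (rule poly_mapping_eqI)
    (auto simp: lookup_sum lookup_single when_def sum.delta in_keys_iff)

lemma mpoly_eval_mult [simp]: "mpoly_eval (p * q) x = mpoly_eval p x * mpoly_eval q x"
proof -
  have "p * q = (\<Sum>a\<in>Poly_Mapping.keys p. Poly_Mapping.single a (Poly_Mapping.lookup p a)) *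
    (\<Sum>b\<in>Poly_Mapping.keys q. Poly_Mapping.single b (Poly_Mapping.lookup q b))"
    by (simp flip: mpoly_eq_sum_single)
  also have "\<dots> = (\<Sum>a\<in>Poly_Mapping.keys p. \<Sum>b\<in>Poly_Mapping.keys q.
      Poly_Mapping.single (a + b) (Poly_Mapping.lookup p a * Poly_Mapping.lookup q b))"
    by (simp add: sum_product mult_single)
  finally show ?thesis
    by (simp add: mpoly_eval_def[of p] mpoly_eval_def[of q] sum_product monom_eval_add mult_ac)
qed

lemma mpoly_eval_one [simp]: "mpoly_eval 1 x = 1"
  using mpoly_eval_single[of 0 1 x] by (simp del: mpoly_eval_single)

lemma mpoly_eval_power [simp]: "mpoly_eval (p ^ k) x = mpoly_eval p x ^ k"
  by (induction k) auto

lemma mpoly_eval_prod [simp]: "mpoly_eval (\<Prod>i\<in>I. p i) x = (\<Prod>i\<in>I. mpoly_eval (p i) x)"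
  by (induction I rule: infinite_finite_induct) auto

lemma mpoly_eval_var [simp]: "mpoly_eval (mpoly_var v) x = x $ v"
  by (simp add: mpoly_var_def)

lemma continuous_on_mpoly_eval [continuous_intros]: "continuous_on S (mpoly_eval p)"
  unfolding mpoly_eval_def monom_eval_def by (intro continuous_intros)

definition monom_degree :: "('v::finite \<Rightarrow>\<^sub>0 nat) \<Rightarrow> nat" where
  "monom_degree a = (\<Sum>v\<in>UNIV. Poly_Mapping.lookup a v)"

lemma mpolys_upto_iff: "p \<in> mpolys_upto k \<longleftrightarrow> (\<forall>a\<in>Poly_Mapping.keys p. monom_degree a \<le> k)"
  by (simp add: mpolys_upto_def monom_degree_def)

lemma monom_degree_add [simp]: "monom_degree (a + b) = monom_degree a + monom_degree b"
  by (simp add: monom_degree_def lookup_add sum.distrib)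

lemma monom_degree_single [simp]: "monom_degree (Poly_Mapping.single v k) = k"
proof -
  have "monom_degree (Poly_Mapping.single v k) = (\<Sum>u\<in>UNIV. if u = v then k else 0)"
    unfolding monom_degree_def by (rule sum.cong) (auto simp: lookup_single when_def)
  then show ?thesis by simp
qed

lemma monom_split:
  fixes a :: "'v \<Rightarrow>\<^sub>0 nat"
  assumes "k \<le> Poly_Mapping.lookup a v"
  shows "a = (a - Poly_Mapping.single v k) + Poly_Mapping.single v k"
  by (rule poly_mapping_eqI) (use assms in \<open>auto simp: lookup_add lookup_minus lookup_single when_def\<close>)

lemma mpolys_upto_zero [simp]: "0 \<in> mpolys_upto k"
  by (simp add: mpolys_upto_iff)

lemma mpolys_upto_mono: "p \<in> mpolys_upto k \<Longrightarrow> k \<le> l \<Longrightarrow> p \<in> mpolys_upto l"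
  by (force simp: mpolys_upto_iff)

lemma mpolys_upto_add: "p \<in> mpolys_upto k \<Longrightarrow> q \<in> mpolys_upto k \<Longrightarrow> p + q \<in> mpolys_upto k"
  using Poly_Mapping.keys_add[of p q] by (auto simp: mpolys_upto_iff)

lemma mpolys_upto_uminus: "p \<in> mpolys_upto k \<Longrightarrow> - p \<in> mpolys_upto k"
  by (auto simp: mpolys_upto_iff in_keys_iff)

lemma mpolys_upto_diff: "p \<in> mpolys_upto k \<Longrightarrow> q \<in> mpolys_upto k \<Longrightarrow> p - q \<in> mpolys_upto k"
  using mpolys_upto_add[of p k "- q"] mpolys_upto_uminus[of q k] by simp

lemma mpolys_upto_sum: "(\<And>i. i \<in> I \<Longrightarrow> p i \<in> mpolys_upto k) \<Longrightarrow> (\<Sum>i\<in>I. p i) \<in> mpolys_upto k"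
  by (induction I rule: infinite_finite_induct) (auto intro: mpolys_upto_add)

lemma mpolys_upto_single: "c = 0 \<or> monom_degree a \<le> k \<Longrightarrow> Poly_Mapping.single a c \<in> mpolys_upto k"
  by (auto simp: mpolys_upto_iff)

lemma mpolys_upto_mult:
  assumes "p \<in> mpolys_upto k" "q \<in> mpolys_upto l"
  shows "p * q \<in> mpolys_upto (k + l)"
  using Poly_Mapping.keys_mult[of p q] assms by (force simp: mpolys_upto_iff intro: add_mono)

lemma mpolys_upto_one [simp]: "1 \<in> mpolys_upto k"
  using mpolys_upto_single[of 1 0 k] by (simp add: monom_degree_def)

lemma mpolys_upto_power: "p \<in> mpolys_upto k \<Longrightarrow> p ^ j \<in> mpolys_upto (j * k)"
  by (induction j) (auto intro: mpolys_upto_mult)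

lemma mpolys_upto_var: "1 \<le> k \<Longrightarrow> mpoly_var v \<in> mpolys_upto k"
  unfolding mpoly_var_def by (rule mpolys_upto_single) simp

lemma mpolys_upto_pderiv:
  assumes "p \<in> mpolys_upto k"
  shows "mpoly_pderiv v p \<in> mpolys_upto (k - 1)"
  unfolding mpoly_pderiv_def
proof (intro mpolys_upto_sum mpolys_upto_single)
  fix a assume a: "a \<in> Poly_Mapping.keys p"
  then have "monom_degree a \<le> k" using assms by (simp add: mpolys_upto_iff)
  moreover have "monom_degree a = monom_degree (a - Poly_Mapping.single v 1) + 1"
    if "1 \<le> Poly_Mapping.lookup a v"
    using arg_cong[OF monom_split[OF that], of monom_degree] by simp
  ultimately show "Poly_Mapping.lookup p a * real (Poly_Mapping.lookup a v) = 0 \<or>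
      monom_degree (a - Poly_Mapping.single v 1) \<le> k - 1"
    by (cases "Poly_Mapping.lookup a v") auto
qed

text \<open>Multiplying by the exponent removes the case distinction: if \<open>v\<close> does not occur in \<open>a\<close>, both
  truncated subtractions are wrong, but both sides vanish. The right-hand side is the form in which
  the derivative of a product of powers appears, both for limits and for abstract derivations.\<close>

lemma monom_eval_lower_exponent:
  "real (Poly_Mapping.lookup a v) * monom_eval (a - Poly_Mapping.single v 1) x =
   real (Poly_Mapping.lookup a v) * (x $ v) ^ (Poly_Mapping.lookup a v - 1) *
     (\<Prod>u\<in>UNIV - {v}. (x $ u) ^ Poly_Mapping.lookup a u)"
proof -
  have "monom_eval (a - Poly_Mapping.single v 1) x =
    (x $ v) ^ Poly_Mapping.lookup (a - Poly_Mapping.single v 1) v *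
     (\<Prod>u\<in>UNIV - {v}. (x $ u) ^ Poly_Mapping.lookup (a - Poly_Mapping.single v 1) u)"
    unfolding monom_eval_def by (rule prod.remove) auto
  also have "\<dots> = (x $ v) ^ (Poly_Mapping.lookup a v - 1) *
     (\<Prod>u\<in>UNIV - {v}. (x $ u) ^ Poly_Mapping.lookup a u)"
    by (intro arg_cong2[of _ _ _ _ "(*)"] prod.cong) (auto simp: lookup_minus lookup_single when_def)
  finally show ?thesis by simp
qed

lemma mpoly_eval_pderiv:
  "mpoly_eval (mpoly_pderiv v p) x = (\<Sum>a\<in>Poly_Mapping.keys p. Poly_Mapping.lookup p a *
     (real (Poly_Mapping.lookup a v) * (x $ v) ^ (Poly_Mapping.lookup a v - 1) *
     (\<Prod>u\<in>UNIV - {v}. (x $ u) ^ Poly_Mapping.lookup a u)))"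
  unfolding mpoly_pderiv_def mpoly_eval_sum mpoly_eval_single monom_eval_lower_exponent[symmetric]
  by (simp only: mult.assoc)

lemma mpoly_eval_has_partial_derivative:
  "((\<lambda>s. mpoly_eval p (x + s *\<^sub>R axis v 1)) has_real_derivative
      mpoly_eval (mpoly_pderiv v p) x) (at 0)"
proof -
  have *: "mpoly_eval p (x + s *\<^sub>R axis v 1) =
    (\<Sum>a\<in>Poly_Mapping.keys p. Poly_Mapping.lookup p a * ((x $ v + s) ^ Poly_Mapping.lookup a v *
       (\<Prod>u\<in>UNIV - {v}. (x $ u) ^ Poly_Mapping.lookup a u)))" for s
  proof -
    have "monom_eval a (x + s *\<^sub>R axis v 1) = (x $ v + s) ^ Poly_Mapping.lookup a v *
       (\<Prod>u\<in>UNIV - {v}. (x $ u) ^ Poly_Mapping.lookup a u)" for a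
      unfolding monom_eval_def
      by (subst prod.remove[of _ v]) (auto simp: axis_def intro!: prod.cong)
    then show ?thesis by (simp add: mpoly_eval_def)
  qed
  show ?thesis
    unfolding * mpoly_eval_pderiv by (auto intro!: derivative_eq_intros sum.cong)
qed

lemma lookup_extend_exponent [simp]:
  "Poly_Mapping.lookup (extend_exponent a :: ('n + 'k) \<Rightarrow>\<^sub>0 nat) (Inl i) = Poly_Mapping.lookup a i"
  "Poly_Mapping.lookup (extend_exponent a :: ('n + 'k) \<Rightarrow>\<^sub>0 nat) (Inr k) = 0"
  by (auto simp: extend_exponent_def lookup_sum lookup_single when_def in_keys_iff)

lemma monom_eval_extend [simp]:
  fixes x :: "real^'n" and l :: "real^'k"
  shows "monom_eval (extend_exponent a) (join_vec x l) = monom_eval a x"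
  unfolding monom_eval_def UNIV_Plus_UNIV[symmetric]
  by (subst prod.Plus) (auto simp: join_vec_def)

lemma mpoly_eval_extend [simp]:
  fixes x :: "real^'n" and l :: "real^'k"
  shows "mpoly_eval (extend_mpoly p) (join_vec x l) = mpoly_eval p x"
  by (simp add: extend_mpoly_def mpoly_eval_def[of p])

lemma mpolys_upto_extend:
  fixes p :: "'n::finite mpoly"
  assumes "p \<in> mpolys_upto k"
  shows "(extend_mpoly p :: ('n + 'k::finite) mpoly) \<in> mpolys_upto k"
  unfolding extend_mpoly_def
proof (intro mpolys_upto_sum mpolys_upto_single disjI2)
  fix a assume "a \<in> Poly_Mapping.keys p"
  moreover have "monom_degree (extend_exponent a :: ('n + 'k) \<Rightarrow>\<^sub>0 nat) = monom_degree a"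
    unfolding monom_degree_def UNIV_Plus_UNIV[symmetric] by (subst sum.Plus) auto
  ultimately show "monom_degree (extend_exponent a :: ('n + 'k) \<Rightarrow>\<^sub>0 nat) \<le> k"
    using assms by (simp add: mpolys_upto_iff)
qed

section \<open>Counting critical points of perturbations by pure powers\<close>

text \<open>Gaussian elimination: an equation with a nonzero coefficient at \<open>z0\<close> is used to eliminate the
  unknown \<open>z0\<close> from the other equations, which leaves one equation and one unknown fewer.\<close>

lemma homogeneous_system_nontrivial_solution:
  fixes A :: "'a \<Rightarrow> 'b \<Rightarrow> real"
  assumes "finite E" "finite Z" "card E < card Z"
  shows "\<exists>c. (\<exists>z\<in>Z. c z \<noteq> 0) \<and> (\<forall>e\<in>E. (\<Sum>z\<in>Z. c z * A e z) = 0)"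
  using assms
proof (induction E arbitrary: Z A rule: finite_induct)
  case empty
  then have "Z \<noteq> {}" by auto
  then show ?case by (intro exI[of _ "\<lambda>_. 1"]) auto
next
  case (insert e E)
  show ?case
  proof (cases "\<forall>z\<in>Z. A e z = 0")
    case True
    have "card E < card Z" using insert by simp
    from insert.IH[OF insert.prems(1) this, of A] obtain c
      where "\<exists>z\<in>Z. c z \<noteq> 0" "\<forall>e\<in>E. (\<Sum>z\<in>Z. c z * A e z) = 0" by blast
    with True show ?thesis by (intro exI[of _ c]) auto
  next
    case False
    then obtain z0 where z0: "z0 \<in> Z" "A e z0 \<noteq> 0" by blast
    let ?Z = "Z - {z0}"
    let ?A = "\<lambda>a z. A a z - A e z * A a z0 / A e z0"
    have "card E < card ?Z" using insert z0 by simp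
    from insert.IH[OF _ this, of ?A] insert.prems(1) obtain c where c: "\<exists>z\<in>?Z. c z \<noteq> 0"
      "\<And>a. a \<in> E \<Longrightarrow> (\<Sum>z\<in>?Z. c z * ?A a z) = 0" by auto
    define c' where "c' z = (if z = z0 then - (\<Sum>z\<in>?Z. c z * A e z) / A e z0 else c z)" for z
    have sum_c': "(\<Sum>z\<in>Z. c' z * A a z) =
        (\<Sum>z\<in>?Z. c z * A a z) - (\<Sum>z\<in>?Z. c z * A e z) * A a z0 / A e z0" for a
    proof -
      have "(\<Sum>z\<in>Z. c' z * A a z) = c' z0 * A a z0 + (\<Sum>z\<in>?Z. c' z * A a z)"
        using z0 insert.prems(1) by (simp add: sum.remove)
      also have "(\<Sum>z\<in>?Z. c' z * A a z) = (\<Sum>z\<in>?Z. c z * A a z)"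
        by (rule sum.cong) (auto simp: c'_def)
      finally show ?thesis by (simp add: c'_def)
    qed
    have "(\<Sum>z\<in>Z. c' z * A a z) = 0" if "a \<in> insert e E" for a
    proof (cases "a = e")
      case True
      then show ?thesis using z0 by (simp add: sum_c')
    next
      case False
      then have "(\<Sum>z\<in>?Z. c z * ?A a z) = 0" using that c by auto
      moreover have "(\<Sum>z\<in>?Z. c z * ?A a z) =
          (\<Sum>z\<in>?Z. c z * A a z) - (\<Sum>z\<in>?Z. c z * A e z) * A a z0 / A e z0"
        by (simp add: right_diff_distrib sum_subtractf sum_distrib_right sum_divide_distrib mult.assoc)
      ultimately show ?thesis by (simp add: sum_c')
    qed
    moreover have "\<exists>z\<in>Z. c' z \<noteq> 0" using c(1) by (auto simp: c'_def)
    ultimately show ?thesis by blast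
  qed
qed

lemma finite_reduced_monomials:
  "finite {a :: 'v::finite \<Rightarrow>\<^sub>0 nat. \<forall>v. Poly_Mapping.lookup a v \<le> k}" (is "finite ?E")
  and card_reduced_monomials_le:
  "card {a :: 'v::finite \<Rightarrow>\<^sub>0 nat. \<forall>v. Poly_Mapping.lookup a v \<le> k} \<le> (k + 1) ^ CARD('v)"
proof -
  have inj: "inj_on Poly_Mapping.lookup ?E"
    by (auto intro!: inj_onI poly_mapping_eqI)
  have sub: "Poly_Mapping.lookup ` ?E \<subseteq> (UNIV :: 'v set) \<rightarrow>\<^sub>E {..k}" by auto
  have fin: "finite ((UNIV :: 'v set) \<rightarrow>\<^sub>E {..k})" by (intro finite_PiE) auto
  then show "finite ?E" using inj sub by (meson finite_imageD finite_subset)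
  have "card ?E \<le> card ((UNIV :: 'v set) \<rightarrow>\<^sub>E {..k})"
    using card_inj_on_le[OF inj sub fin] .
  then show "card ?E \<le> (k + 1) ^ CARD('v)" by (simp add: card_PiE)
qed

text \<open>A weak Bezout bound that needs no intersection theory. On \<open>Z\<close> every power \<open>z\<^sub>v ^ (k + 1)\<close>
  agrees with a polynomial of lower degree, so by induction on the degree every monomial agrees on \<open>Z\<close>
  with a combination of monomials having all exponents at most \<open>k\<close>. There are \<open>(k + 1) ^ CARD('v)\<close>
  of those. If \<open>Z\<close> were larger, some nonzero weight on \<open>Z\<close> would annihilate all of them, hence all
  polynomials; but products of differences of \<open>F\<close> isolate each single point of \<open>Z\<close>.\<close>

lemma card_le_if_pure_powers_reducible:
  fixes Z :: "(real^'v::finite) set" and F :: "'v mpoly"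
  assumes "finite Z" and inj: "inj_on (mpoly_eval F) Z"
    and r: "\<And>v. r v \<in> mpolys_upto k" "\<And>v z. z \<in> Z \<Longrightarrow> (z $ v) ^ (k + 1) = mpoly_eval (r v) z"
  shows "card Z \<le> (k + 1) ^ CARD('v)"
proof (rule ccontr)
  assume "\<not> ?thesis"
  let ?E = "{a :: 'v \<Rightarrow>\<^sub>0 nat. \<forall>v. Poly_Mapping.lookup a v \<le> k}"
  from \<open>\<not> ?thesis\<close> have "card ?E < card Z"
    using card_reduced_monomials_le[where 'v = 'v and k = k] by linarith
  from homogeneous_system_nontrivial_solution[OF finite_reduced_monomials \<open>finite Z\<close> this, of monom_eval]
  obtain c where c: "\<exists>z\<in>Z. c z \<noteq> 0" "\<And>a. a \<in> ?E \<Longrightarrow> (\<Sum>z\<in>Z. c z * monom_eval a z) = 0"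
    by blast
  \<comment> \<open>The functional on polynomials defined by the weights; it vanishes on reduced monomials.\<close>
  define L where "L p = (\<Sum>z\<in>Z. c z * mpoly_eval p z)" for p
  have L_sum: "L p = (\<Sum>a\<in>Poly_Mapping.keys p. Poly_Mapping.lookup p a * (\<Sum>z\<in>Z. c z * monom_eval a z))" for p
  proof -
    have "L p = (\<Sum>z\<in>Z. \<Sum>a\<in>Poly_Mapping.keys p. Poly_Mapping.lookup p a * (c z * monom_eval a z))"
      unfolding L_def by (simp add: mpoly_eval_def sum_distrib_left mult_ac)
    then show ?thesis by (subst (asm) sum.swap) (simp add: sum_distrib_left)
  qed
  have monom: "(\<Sum>z\<in>Z. c z * monom_eval a z) = 0" for a
  proof (induction a rule: measure_induct_rule[of monom_degree])
    case (less a)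
    show ?case
    proof (cases "a \<in> ?E")
      case True
      then show ?thesis by (rule c)
    next
      case False
      then obtain v where v: "k + 1 \<le> Poly_Mapping.lookup a v" by (auto simp: not_le Suc_le_eq)
      define b where "b = a - Poly_Mapping.single v (k + 1)"
      have a: "a = b + Poly_Mapping.single v (k + 1)" using monom_split[OF v] by (simp add: b_def)
      \<comment> \<open>On the points of the set, the monomial agrees with a polynomial of strictly smaller degree.\<close>
      let ?p = "Poly_Mapping.single b 1 * r v"
      have "?p \<in> mpolys_upto (monom_degree b + k)"
        by (intro mpolys_upto_mult mpolys_upto_single r) simp
      then have "monom_degree a' < monom_degree a" if "a' \<in> Poly_Mapping.keys ?p" for a'
        using that by (fastforce simp: mpolys_upto_iff a)
      then have "L ?p = 0" unfolding L_sum by (simp add: less)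
      moreover have "L ?p = (\<Sum>z\<in>Z. c z * monom_eval a z)"
        unfolding L_def by (rule sum.cong) (simp_all add: a monom_eval_add r(2)[symmetric])
      ultimately show ?thesis by simp
    qed
  qed
  then have L: "L p = 0" for p by (simp add: L_sum)
  from c(1) obtain z0 where z0: "z0 \<in> Z" "c z0 \<noteq> 0" by blast
  \<comment> \<open>Vanishes at every point of the set except the chosen one.\<close>
  let ?p = "\<Prod>z\<in>Z - {z0}. F - Poly_Mapping.single 0 (mpoly_eval F z)"
  have eval_p: "mpoly_eval ?p y = (\<Prod>z\<in>Z - {z0}. mpoly_eval F y - mpoly_eval F z)" for y
    by simp
  have "L ?p = (\<Sum>y\<in>Z. if y = z0 then c z0 * mpoly_eval ?p z0 else 0)"
    unfolding L_def
  proof (rule sum.cong)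
    fix y assume "y \<in> Z"
    show "c y * mpoly_eval ?p y = (if y = z0 then c z0 * mpoly_eval ?p z0 else 0)"
      using \<open>y \<in> Z\<close> \<open>finite Z\<close> unfolding eval_p by (auto intro: prod_zero)
  qed simp
  also have "\<dots> = c z0 * mpoly_eval ?p z0"
    using z0 \<open>finite Z\<close> by simp
  also have "\<dots> \<noteq> 0"
    using z0 inj \<open>finite Z\<close> unfolding eval_p by (auto simp: inj_on_def)
  finally show False using L by simp
qed

lemma compact_power_sum_sublevel:
  fixes R :: real
  assumes "even k"
  shows "compact {z :: real^'v::finite. (\<Sum>v\<in>UNIV. (z $ v) ^ (k + 2)) \<le> R}"
proof -
  let ?S = "{z :: real^'v. (\<Sum>v\<in>UNIV. (z $ v) ^ (k + 2)) \<le> R}"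
  have "closed ?S" by (intro closed_Collect_le continuous_intros)
  moreover have "norm z \<le> real CARD('v) * max 1 R" if "z \<in> ?S" for z
  proof -
    have "\<bar>z $ v\<bar> \<le> max 1 R" for v
    proof (cases "\<bar>z $ v\<bar> \<le> 1")
      case False
      have "\<bar>z $ v\<bar> \<le> \<bar>z $ v\<bar> ^ (k + 2)" using False power_increasing[of 1 "k + 2" "\<bar>z $ v\<bar>"] by simp
      also have "\<dots> = (z $ v) ^ (k + 2)" using assms by (intro power_even_abs) simp
      also have "\<dots> \<le> (\<Sum>v\<in>UNIV. (z $ v) ^ (k + 2))"
        using assms by (intro member_le_sum zero_le_even_power) auto
      also have "\<dots> \<le> max 1 R" using that by simp
      finally show ?thesis .
    qed auto
    then have "(\<Sum>v\<in>UNIV. \<bar>z $ v\<bar>) \<le> (\<Sum>v\<in>(UNIV :: 'v set). max 1 R)" by (intro sum_mono)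
    with norm_le_l1_cart[of z] show ?thesis by simp
  qed
  then have "bounded ?S" unfolding bounded_iff by blast
  ultimately show ?thesis by (simp add: compact_eq_bounded_closed)
qed

text \<open>Since the perturbation is a sum of powers of the single variables, its gradient is diagonal. Each
  equation of the critical system therefore expresses one pure power by a polynomial of lower degree.\<close>

lemma perturbed_local_minimum_critical:
  fixes Q :: "'v::finite mpoly"
  assumes "open U" "y \<in> U" and min: "\<And>z. z \<in> U \<Longrightarrow>
     mpoly_eval Q y + \<epsilon> * (\<Sum>u\<in>UNIV. (y $ u) ^ (k + 2)) \<le> mpoly_eval Q z + \<epsilon> * (\<Sum>u\<in>UNIV. (z $ u) ^ (k + 2))"
  shows "mpoly_eval (mpoly_pderiv v Q) y + \<epsilon> * (real (k + 2) * (y $ v) ^ (k + 1)) = 0"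
proof -
  let ?P = "\<lambda>s. mpoly_eval Q (y + s *\<^sub>R axis v 1) +
     \<epsilon> * (\<Sum>u\<in>UNIV. ((y + s *\<^sub>R axis v 1) $ u) ^ (k + 2))"
  obtain e where e: "e > 0" "ball y e \<subseteq> U" using assms(1,2) openE by blast
  have "((\<lambda>s. \<Sum>u\<in>UNIV. ((y + s *\<^sub>R axis v 1) $ u) ^ (k + 2)) has_real_derivative
     (\<Sum>u\<in>UNIV. if u = v then real (k + 2) * (y $ v) ^ (k + 1) else 0)) (at 0)"
  proof (intro DERIV_sum)
    fix u
    have power: "((\<lambda>s. (c + s) ^ n) has_real_derivative real n * c ^ (n - 1)) (at 0)" for c n
      by (auto intro!: derivative_eq_intros)
    show "((\<lambda>s. ((y + s *\<^sub>R axis v 1) $ u) ^ (k + 2)) has_real_derivative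
       (if u = v then real (k + 2) * (y $ v) ^ (k + 1) else 0)) (at 0)"
      using power[of "y $ v" "k + 2"] by (cases "u = v") (simp_all add: axis_def)
  qed
  then have "(?P has_real_derivative mpoly_eval (mpoly_pderiv v Q) y +
      \<epsilon> * (real (k + 2) * (y $ v) ^ (k + 1))) (at 0)"
    by (intro DERIV_add DERIV_cmult mpoly_eval_has_partial_derivative) simp
  moreover have "\<forall>s. \<bar>0 - s\<bar> < e \<longrightarrow> ?P 0 \<le> ?P s"
  proof (intro allI impI)
    fix s :: real assume "\<bar>0 - s\<bar> < e"
    then have "y + s *\<^sub>R axis v 1 \<in> ball y e" by (simp add: dist_norm)
    with e min[of "y + s *\<^sub>R axis v 1"] show "?P 0 \<le> ?P s" by auto
  qed
  ultimately show ?thesis using e(1) DERIV_local_min by blast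
qed

text \<open>Only countably many radii are excluded by \<open>X\<close>, while an interval of radii keeps the
  neighbourhoods of the points of \<open>T\<close> disjoint.\<close>

lemma isolating_radius:
  fixes T X :: "real set"
  assumes "finite T" "countable X"
  obtains \<delta> where "\<delta> > 0" "\<And>t t'. t \<in> T \<Longrightarrow> t' \<in> T \<Longrightarrow> t \<noteq> t' \<Longrightarrow> 2 * \<delta> \<le> \<bar>t - t'\<bar>"
    "\<And>t x. t \<in> T \<Longrightarrow> x \<in> X \<Longrightarrow> \<bar>x - t\<bar> \<noteq> \<delta>"
proof -
  define G where "G = (\<lambda>(t, t'). \<bar>t - t'\<bar>) ` {(t, t') \<in> T \<times> T. t \<noteq> t'}"
  have "finite G" unfolding G_def
    by (rule finite_imageI, rule finite_subset[of _ "T \<times> T"]) (use assms in auto)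
  define \<eta> where "\<eta> = Min (insert 1 G)"
  have "\<eta> > 0" unfolding \<eta>_def using \<open>finite G\<close> by (subst Min_gr_iff) (auto simp: G_def)
  define D where "D = (\<Union>t\<in>T. (\<lambda>x. \<bar>x - t\<bar>) ` X)"
  have "countable D"
    unfolding D_def by (intro countable_UN countable_image assms(2) countable_finite[OF assms(1)])
  moreover have "uncountable {0<..<\<eta> / 2}" using \<open>\<eta> > 0\<close> by (simp add: uncountable_open_interval)
  ultimately have "\<not> {0<..<\<eta> / 2} \<subseteq> D" using countable_subset by blast
  then obtain \<delta> where "\<delta> \<in> {0<..<\<eta> / 2}" "\<delta> \<notin> D" by blast
  then have \<delta>: "0 < \<delta>" "\<delta> < \<eta> / 2" "\<delta> \<notin> D" by simp_all
  show ?thesis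
  proof
    show "2 * \<delta> \<le> \<bar>t - t'\<bar>" if "t \<in> T" "t' \<in> T" "t \<noteq> t'" for t t'
    proof -
      have "\<bar>t - t'\<bar> \<in> G" using that by (auto simp: G_def)
      then have "\<eta> \<le> \<bar>t - t'\<bar>" unfolding \<eta>_def using \<open>finite G\<close> by (intro Min_le) auto
      with \<delta> show ?thesis by simp
    qed
    show "\<bar>x - t\<bar> \<noteq> \<delta>" if "t \<in> T" "x \<in> X" for t x
      using \<delta>(3) that unfolding D_def by blast
  qed (rule \<delta>(1))
qed

text \<open>Let \<open>\<theta>\<close> be the sum of the powers \<open>z\<^sub>v ^ (k + 2)\<close>. For each of finitely many values \<open>t\<close> of \<open>F\<close>
  on the zeros of \<open>Q\<close>, the function \<open>Q + \<epsilon> \<theta>\<close> is minimised over the compact set where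
  \<open>\<theta> \<le> R\<close> and \<open>F\<close> is within \<open>\<delta>\<close> of \<open>t\<close>. Countability of the set of values lets \<open>\<delta>\<close> be chosen
  so that \<open>Q\<close> has no zero where \<open>F\<close> is exactly at distance \<open>\<delta>\<close> from \<open>t\<close>; hence \<open>Q\<close> is bounded below
  there, and for small \<open>\<epsilon>\<close> the minimum is attained in the interior. These minima are critical points
  with pairwise different values of \<open>F\<close>, and \<open>card_le_if_pure_powers_reducible\<close> bounds their number.\<close>

theorem card_values_on_zero_set_le:
  fixes Q F :: "'v::finite mpoly"
  assumes "even k" "Q \<in> mpolys_upto k" and nonneg: "\<And>z. 0 \<le> mpoly_eval Q z"
    and count: "countable (mpoly_eval F ` {z. mpoly_eval Q z = 0})"
    and T: "finite T" "T \<subseteq> mpoly_eval F ` {z. mpoly_eval Q z = 0}"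
  shows "card T \<le> (k + 1) ^ CARD('v)"
proof -
  define \<theta> where "\<theta> z = (\<Sum>v\<in>UNIV. (z $ v) ^ (k + 2))" for z :: "real^'v"
  have \<theta>_cont [continuous_intros]: "continuous_on S \<theta>" for S unfolding \<theta>_def by (intro continuous_intros)
  have \<theta>_nonneg: "0 \<le> \<theta> z" for z
    unfolding \<theta>_def using \<open>even k\<close> by (intro sum_nonneg zero_le_even_power) simp
  from T(2) have "\<forall>t\<in>T. \<exists>z. mpoly_eval Q z = 0 \<and> mpoly_eval F z = t" by auto
  then obtain p where p: "\<And>t. t \<in> T \<Longrightarrow> mpoly_eval Q (p t) = 0" "\<And>t. t \<in> T \<Longrightarrow> mpoly_eval F (p t) = t"
    by metis
  define R where "R = 1 + (\<Sum>t\<in>T. \<theta> (p t))"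
  have "R > 0" unfolding R_def using \<theta>_nonneg by (intro add_pos_nonneg sum_nonneg) auto
  have R: "\<theta> (p t) < R" if "t \<in> T" for t
    using member_le_sum[of t T "\<lambda>t. \<theta> (p t)"] that T(1) \<theta>_nonneg by (simp add: R_def)
  from isolating_radius[OF T(1) count] obtain \<delta> where \<delta>: "\<delta> > 0"
    "\<And>t t'. t \<in> T \<Longrightarrow> t' \<in> T \<Longrightarrow> t \<noteq> t' \<Longrightarrow> 2 * \<delta> \<le> \<bar>t - t'\<bar>"
    "\<And>t x. t \<in> T \<Longrightarrow> x \<in> mpoly_eval F ` {z. mpoly_eval Q z = 0} \<Longrightarrow> \<bar>x - t\<bar> \<noteq> \<delta>" by blast
  have "compact {z. \<theta> z \<le> R}"
    unfolding \<theta>_def by (rule compact_power_sum_sublevel) fact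
  then have compact: "compact ({z. \<theta> z \<le> R} \<inter> C)" if "closed C" for C
    using that by (rule compact_Int_closed)
  \<comment> \<open>The part of the boundaries of the compact sets where \<open>F\<close> is at distance \<open>\<delta>\<close> from some value.\<close>
  define E where "E = {z. \<theta> z \<le> R} \<inter> (\<Union>t\<in>T. {z. \<bar>mpoly_eval F z - t\<bar> = \<delta>})"
  have "compact E"
    unfolding E_def using T(1) by (intro compact closed_UN ballI closed_Collect_eq continuous_intros)
  have "\<exists>\<kappa>>0. \<forall>z\<in>E. \<kappa> \<le> mpoly_eval Q z"
  proof (cases "E = {}")
    case True
    then show ?thesis by (intro exI[of _ 1]) auto
  next
    case False
    obtain e where e: "e \<in> E" "\<And>z. z \<in> E \<Longrightarrow> mpoly_eval Q e \<le> mpoly_eval Q z"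
      using continuous_attains_inf[OF \<open>compact E\<close> False continuous_on_mpoly_eval] by blast
    then have "mpoly_eval Q e \<noteq> 0" using \<delta>(3) unfolding E_def by blast
    with nonneg[of e] e show ?thesis by (intro exI[of _ "mpoly_eval Q e"]) auto
  qed
  then obtain \<kappa> where \<kappa>: "\<kappa> > 0" "\<And>z. z \<in> E \<Longrightarrow> \<kappa> \<le> mpoly_eval Q z" by blast
  \<comment> \<open>With this choice the value at a zero with \<open>\<theta> < R\<close> stays below both \<open>\<epsilon> * R\<close> and the minimum of \<open>Q\<close> on \<open>E\<close>.\<close>
  define \<epsilon> where "\<epsilon> = \<kappa> / R"
  have "\<epsilon> > 0" using \<kappa> \<open>R > 0\<close> by (simp add: \<epsilon>_def)
  have "\<exists>y. \<bar>mpoly_eval F y - t\<bar> < \<delta> \<and> (\<forall>v. mpoly_eval (mpoly_pderiv v Q) y +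
      \<epsilon> * (real (k + 2) * (y $ v) ^ (k + 1)) = 0)" if "t \<in> T" for t
  proof -
    let ?P = "\<lambda>z. mpoly_eval Q z + \<epsilon> * \<theta> z"
    let ?K = "{z. \<theta> z \<le> R} \<inter> {z. \<bar>mpoly_eval F z - t\<bar> \<le> \<delta>}"
    let ?U = "{z. \<theta> z < R} \<inter> {z. \<bar>mpoly_eval F z - t\<bar> < \<delta>}"
    have "compact ?K" by (intro compact closed_Collect_le continuous_intros)
    moreover have pK: "p t \<in> ?K" using R[OF that] p that \<delta>(1) by simp
    moreover have "continuous_on ?K ?P" by (intro continuous_intros)
    ultimately obtain y where y: "y \<in> ?K" "\<And>z. z \<in> ?K \<Longrightarrow> ?P y \<le> ?P z"
      using continuous_attains_inf[of ?K ?P] by blast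
    have "?P y \<le> \<epsilon> * \<theta> (p t)" using y(2)[OF pK] p that by simp
    also have "\<dots> < \<epsilon> * R" using R[OF that] \<open>\<epsilon> > 0\<close> by simp
    finally have less: "?P y < \<epsilon> * R" .
    then have "\<epsilon> * \<theta> y < \<epsilon> * R" using nonneg[of y] by linarith
    then have 1: "\<theta> y < R" using \<open>\<epsilon> > 0\<close> by simp
    have "\<epsilon> * R = \<kappa>" using \<open>R > 0\<close> by (simp add: \<epsilon>_def)
    moreover have "0 \<le> \<epsilon> * \<theta> y" using \<open>\<epsilon> > 0\<close> \<theta>_nonneg by simp
    ultimately have "y \<notin> E" using \<kappa>(2)[of y] less by linarith
    then have "\<bar>mpoly_eval F y - t\<bar> \<noteq> \<delta>" using y(1) that by (auto simp: E_def)
    with 1 y(1) have "y \<in> ?U" by simp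
    moreover have "open ?U" by (intro open_Int open_Collect_less continuous_intros)
    moreover have "?P y \<le> ?P z" if "z \<in> ?U" for z using that y(2)[of z] by simp
    ultimately show ?thesis
      using perturbed_local_minimum_critical[of ?U y Q \<epsilon> k] unfolding \<theta>_def by blast
  qed
  then obtain y where y: "\<And>t. t \<in> T \<Longrightarrow> \<bar>mpoly_eval F (y t) - t\<bar> < \<delta>"
    "\<And>t v. t \<in> T \<Longrightarrow> mpoly_eval (mpoly_pderiv v Q) (y t) + \<epsilon> * (real (k + 2) * (y t $ v) ^ (k + 1)) = 0"
    by metis
  have inj: "inj_on (\<lambda>t. mpoly_eval F (y t)) T"
  proof (rule inj_onI, rule ccontr)
    fix t t' assume t: "t \<in> T" "t' \<in> T" "mpoly_eval F (y t) = mpoly_eval F (y t')" "t \<noteq> t'"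
    then show False using y(1)[of t] y(1)[of t'] \<delta>(2)[of t t'] by linarith
  qed
  \<comment> \<open>The critical equations, solved for the pure powers.\<close>
  define r where "r v = Poly_Mapping.single 0 (- 1 / (\<epsilon> * real (k + 2))) * mpoly_pderiv v Q" for v
  have "card (y ` T) \<le> (k + 1) ^ CARD('v)"
  proof (rule card_le_if_pure_powers_reducible)
    show "finite (y ` T)" using T by simp
    show "inj_on (mpoly_eval F) (y ` T)" using inj by (auto simp: inj_on_def)
    show "r v \<in> mpolys_upto k" for v
    proof -
      have "r v \<in> mpolys_upto (0 + (k - 1))"
        unfolding r_def by (intro mpolys_upto_mult mpolys_upto_pderiv assms mpolys_upto_single)
          (simp add: monom_degree_def)
      then show ?thesis by (rule mpolys_upto_mono) simp
    qed
    show "(z $ v) ^ (k + 1) = mpoly_eval (r v) z" if "z \<in> y ` T" for v z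
    proof -
      from that obtain t where t: "t \<in> T" "z = y t" by blast
      define c where "c = \<epsilon> * real (k + 2)"
      have "c \<noteq> 0" using \<open>\<epsilon> > 0\<close> by (simp add: c_def)
      have "mpoly_eval (mpoly_pderiv v Q) z = - (c * (z $ v) ^ (k + 1))"
        using y(2)[OF t(1), of v] unfolding t(2) c_def mult.assoc by linarith
      then have "mpoly_eval (r v) z = - 1 / c * - (c * (z $ v) ^ (k + 1))"
        unfolding r_def c_def[symmetric] by simp
      also have "\<dots> = (z $ v) ^ (k + 1)" using \<open>c \<noteq> 0\<close> by simp
      finally show ?thesis by simp
    qed
  qed
  moreover have "card (y ` T) = card T" using inj by (intro card_image) (auto simp: inj_on_def)
  ultimately show ?thesis by simp
qed

section \<open>Extension of derivations to the real numbers\<close>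

text \<open>A derivation on a subring of the reals is the same thing as a subring of the dual numbers
  \<open>a + a' \<epsilon>\<close> in which \<open>a = 0\<close> forces \<open>a' = 0\<close>. In this form partial derivations are ordered by inclusion,
  and unions of chains are immediate.\<close>

definition derivation_graph :: "(real \<times> real) set \<Rightarrow> bool" where
  "derivation_graph B \<longleftrightarrow>
     (1, 0) \<in> B \<and>
     (\<forall>a a' b b'. (a, a') \<in> B \<longrightarrow> (b, b') \<in> B \<longrightarrow>
        (a - b, a' - b') \<in> B \<and> (a * b, a * b' + a' * b) \<in> B) \<and>
     (\<forall>a'. (0, a') \<in> B \<longrightarrow> a' = 0)"

text \<open>Pairs of a polynomial with coefficients in the domain and the polynomial of the derivatives of
  its coefficients, i.e. polynomials over the dual numbers in \<open>B\<close>.\<close>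

definition poly_graph :: "(real \<times> real) set \<Rightarrow> (real poly \<times> real poly) set" where
  "poly_graph B = {(U, V). \<forall>i. (coeff U i, coeff V i) \<in> B}"

lemma derivation_graph_zero: "derivation_graph B \<Longrightarrow> (0, 0) \<in> B"
  unfolding derivation_graph_def by (metis diff_self)

lemma derivation_graph_diff:
  "derivation_graph B \<Longrightarrow> (a, a') \<in> B \<Longrightarrow> (b, b') \<in> B \<Longrightarrow> (a - b, a' - b') \<in> B"
  unfolding derivation_graph_def by blast

lemma derivation_graph_add:
  assumes "derivation_graph B" "(a, a') \<in> B" "(b, b') \<in> B"
  shows "(a + b, a' + b') \<in> B"
proof -
  have "(0 - b, 0 - b') \<in> B"
    by (rule derivation_graph_diff[OF assms(1) derivation_graph_zero assms(3)]) fact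
  from derivation_graph_diff[OF assms(1,2) this] show ?thesis by simp
qed

lemma derivation_graph_mult:
  "derivation_graph B \<Longrightarrow> (a, a') \<in> B \<Longrightarrow> (b, b') \<in> B \<Longrightarrow> (a * b, a * b' + a' * b) \<in> B"
  unfolding derivation_graph_def by blast

lemma derivation_graph_sum:
  assumes "derivation_graph B" "\<And>i. i \<in> I \<Longrightarrow> (a i, a' i) \<in> B"
  shows "((\<Sum>i\<in>I. a i), (\<Sum>i\<in>I. a' i)) \<in> B"
  using assms(2)
  by (induction I rule: infinite_finite_induct)
    (auto intro: derivation_graph_add assms derivation_graph_zero)

lemma derivation_graph_of_nat: "derivation_graph B \<Longrightarrow> (real n, 0) \<in> B"
  using derivation_graph_sum[of B "{..<n}" "\<lambda>_. 1" "\<lambda>_. 0"] by (simp add: derivation_graph_def)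

lemma derivation_graph_unique:
  assumes "derivation_graph B" "(a, b) \<in> B" "(a, c) \<in> B"
  shows "b = c"
  using derivation_graph_diff[OF assms] assms(1) by (auto simp: derivation_graph_def)

lemma poly_graph_diff:
  "derivation_graph B \<Longrightarrow> (U, V) \<in> poly_graph B \<Longrightarrow> (U', V') \<in> poly_graph B \<Longrightarrow>
     (U - U', V - V') \<in> poly_graph B"
  by (auto simp: poly_graph_def intro: derivation_graph_diff)

lemma poly_graph_mult:
  assumes "derivation_graph B" "(U, V) \<in> poly_graph B" "(U', V') \<in> poly_graph B"
  shows "(U * U', U * V' + V * U') \<in> poly_graph B"
proof -
  have "((\<Sum>j\<le>i. coeff U j * coeff U' (i - j)),
     (\<Sum>j\<le>i. coeff U j * coeff V' (i - j) + coeff V j * coeff U' (i - j))) \<in> B" for i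
    using assms by (intro derivation_graph_sum derivation_graph_mult) (auto simp: poly_graph_def)
  then show ?thesis by (simp add: poly_graph_def coeff_mult sum.distrib)
qed

lemma poly_graph_monom:
  "derivation_graph B \<Longrightarrow> (a, a') \<in> B \<Longrightarrow> (monom a k, monom a' k) \<in> poly_graph B"
  by (auto simp: poly_graph_def derivation_graph_zero)

lemma poly_graph_pderiv:
  assumes "derivation_graph B" "(U, V) \<in> poly_graph B"
  shows "(pderiv U, pderiv V) \<in> poly_graph B"
proof -
  have "(real n * coeff U n, real n * coeff V n + 0 * coeff U n) \<in> B" for n
    using assms by (intro derivation_graph_mult derivation_graph_of_nat) (auto simp: poly_graph_def)
  from this[of "Suc _"] show ?thesis by (simp add: poly_graph_def coeff_pderiv)
qed

lemma poly_graph_zero: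
  assumes "derivation_graph B" "(0, V) \<in> poly_graph B"
  shows "V = 0"
  using assms by (intro poly_eqI) (auto simp: poly_graph_def derivation_graph_def)

text \<open>The ring generated by \<open>B\<close> and the dual number \<open>a + b \<epsilon>\<close>: the values of the polynomials over \<open>B\<close> at
  that dual number.\<close>

definition extended_graph :: "(real \<times> real) set \<Rightarrow> real \<Rightarrow> real \<Rightarrow> (real \<times> real) set" where
  "extended_graph B a b =
     {(poly U a, poly V a + poly (pderiv U) a * b) | U V. (U, V) \<in> poly_graph B}"

lemma subset_extended_graph:
  assumes "derivation_graph B"
  shows "B \<subseteq> extended_graph B a b"
proof
  fix p assume "p \<in> B"
  then have "([:fst p:], [:snd p:]) \<in> poly_graph B"
    using poly_graph_monom[OF assms, of "fst p" "snd p" 0] by (simp add: monom_0)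
  then have "(poly [:fst p:] a, poly [:snd p:] a + poly (pderiv [:fst p:]) a * b) \<in> extended_graph B a b"
    unfolding extended_graph_def by blast
  then show "p \<in> extended_graph B a b" by (simp add: pderiv_pCons)
qed

lemma generator_in_extended_graph:
  assumes "derivation_graph B"
  shows "(a, b) \<in> extended_graph B a b"
proof -
  have "(monom 1 1, monom 0 1) \<in> poly_graph B"
    using assms by (intro poly_graph_monom) (auto simp: derivation_graph_def)
  then have "(poly (monom 1 1) a, poly (monom 0 1) a + poly (pderiv (monom 1 1)) a * b) \<in> extended_graph B a b"
    unfolding extended_graph_def by blast
  then show ?thesis by (simp add: poly_monom pderiv_monom)
qed

lemma derivation_graph_extended:
  assumes B: "derivation_graph B"
    and wd: "\<And>U V. (U, V) \<in> poly_graph B \<Longrightarrow> poly U a = 0 \<Longrightarrow> poly V a + poly (pderiv U) a * b = 0"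
  shows "derivation_graph (extended_graph B a b)"
  unfolding derivation_graph_def
proof (intro conjI allI impI)
  show "(1, 0) \<in> extended_graph B a b"
    using subset_extended_graph[OF B] B by (auto simp: derivation_graph_def)
next
  fix x x' y y' assume "(x, x') \<in> extended_graph B a b" "(y, y') \<in> extended_graph B a b"
  then obtain U V P Q where UV: "(U, V) \<in> poly_graph B" "x = poly U a" "x' = poly V a + poly (pderiv U) a * b"
    and PQ: "(P, Q) \<in> poly_graph B" "y = poly P a" "y' = poly Q a + poly (pderiv P) a * b"
    by (auto simp: extended_graph_def)
  have "(U - P, V - Q) \<in> poly_graph B" using B UV PQ by (intro poly_graph_diff)
  then have "(poly (U - P) a, poly (V - Q) a + poly (pderiv (U - P)) a * b) \<in> extended_graph B a b"
    unfolding extended_graph_def by blast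
  then show "(x - y, x' - y') \<in> extended_graph B a b"
    by (simp add: UV PQ pderiv_diff algebra_simps)
  have "(U * P, U * Q + V * P) \<in> poly_graph B" using B UV PQ by (intro poly_graph_mult)
  then have "(poly (U * P) a, poly (U * Q + V * P) a + poly (pderiv (U * P)) a * b) \<in> extended_graph B a b"
    unfolding extended_graph_def by blast
  then show "(x * y, x * y' + x' * y) \<in> extended_graph B a b"
    by (simp add: UV PQ pderiv_mult algebra_simps)
next
  fix x' assume "(0, x') \<in> extended_graph B a b"
  then show "x' = 0" using wd by (auto simp: extended_graph_def)
qed

lemma extended_graph_transcendental:
  assumes B: "derivation_graph B"
    and tr: "\<And>U V. (U, V) \<in> poly_graph B \<Longrightarrow> poly U a = 0 \<Longrightarrow> U = 0"
  shows "derivation_graph (extended_graph B a b)"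
proof (rule derivation_graph_extended[OF B])
  fix U V assume UV: "(U, V) \<in> poly_graph B" "poly U a = 0"
  then have "U = 0" by (rule tr)
  with UV poly_graph_zero[OF B, of V] show "poly V a + poly (pderiv U) a * b = 0" by simp
qed

text \<open>The value \<open>b\<close> is forced by a relation \<open>P\<close> of minimal degree: differentiating \<open>P(a) = 0\<close> gives a linear
  equation for \<open>b\<close>, with coefficient \<open>P'(a)\<close>, which is nonzero by minimality because the
  characteristic is zero. Any other relation \<open>U\<close> is compatible with this choice of \<open>b\<close>: subtracting a
  multiple of \<open>P\<close> from a multiple of \<open>U\<close> lowers the degree, and the product rule carries the claim along.\<close>

lemma extended_graph_algebraic:
  assumes B: "derivation_graph B" and UV: "(U, V) \<in> poly_graph B" "poly U a = 0" "U \<noteq> 0"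
  shows "\<exists>b. derivation_graph (extended_graph B a b)"
proof -
  define is_rel where "is_rel S \<longleftrightarrow> (S \<in> poly_graph B \<and> poly (fst S) a = 0 \<and> fst S \<noteq> 0)" for S
  have "is_rel (U, V)" using UV by (simp add: is_rel_def)
  from ex_has_least_nat[of is_rel, OF this, of "\<lambda>S. degree (fst S)"] obtain S
    where "is_rel S" and minimal: "\<And>S'. is_rel S' \<Longrightarrow> degree (fst S) \<le> degree (fst S')" by blast
  then obtain P Q where P: "(P, Q) \<in> poly_graph B" "poly P a = 0" "P \<noteq> 0"
    and min: "\<And>U V. (U, V) \<in> poly_graph B \<Longrightarrow> poly U a = 0 \<Longrightarrow> U \<noteq> 0 \<Longrightarrow> degree P \<le> degree U"
    unfolding is_rel_def by (cases S) force
  have "degree P \<noteq> 0"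
  proof
    assume "degree P = 0"
    then obtain e where "P = [:e:]" by (rule degree_eq_zeroE)
    with P show False by simp
  qed
  have "poly (pderiv P) a \<noteq> 0"
  proof
    assume "poly (pderiv P) a = 0"
    moreover have "pderiv P \<noteq> 0" using \<open>degree P \<noteq> 0\<close> by (simp add: pderiv_eq_0_iff)
    ultimately have "degree P \<le> degree (pderiv P)"
      using min[OF poly_graph_pderiv[OF B P(1)]] by simp
    then show False using \<open>degree P \<noteq> 0\<close> by (simp add: degree_pderiv)
  qed
  define b where "b = - poly Q a / poly (pderiv P) a"
  have b: "poly Q a + poly (pderiv P) a * b = 0"
    using \<open>poly (pderiv P) a \<noteq> 0\<close> by (simp add: b_def)
  have "poly V a + poly (pderiv U) a * b = 0" if "(U, V) \<in> poly_graph B" "poly U a = 0" for U V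
    using that
  \<comment> \<open>The zero polynomial is ranked strictly below the nonzero constants.\<close>
  proof (induction "if U = 0 then 0 else Suc (degree U)" arbitrary: U V rule: less_induct)
    case less
    show ?case
    proof (cases "U = 0")
      case True
      with less poly_graph_zero[OF B, of V] show ?thesis by simp
    next
      case False
      with less min have deg: "degree P \<le> degree U" by blast
      define k where "k = degree U - degree P"
      define c c' l l' where defs: "c = lead_coeff P" "c' = coeff Q (degree P)" "l = lead_coeff U"
        "l' = coeff V (degree U)"
      have cl: "(c, c') \<in> B" "(l, l') \<in> B"
        using P(1) less.prems(1) by (auto simp: poly_graph_def defs)
      \<comment> \<open>Cross-multiplication of leading terms, carried out for polynomials over the dual numbers.\<close>
      define U1 where "U1 = monom c 0 * U - monom l k * P"
      define V1 where "V1 = (monom c 0 * V + monom c' 0 * U) - (monom l k * Q + monom l' k * P)"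
      have UV1: "(U1, V1) \<in> poly_graph B"
        unfolding U1_def V1_def using B cl less.prems(1) P(1)
        by (intro poly_graph_diff poly_graph_mult poly_graph_monom)
      have U1: "poly U1 a = 0" using less.prems(2) P(2) by (simp add: U1_def)
      have "U1 = 0 \<or> degree U1 < degree U"
      proof -
        have "degree (monom c 0 * U) \<le> degree U"
          using degree_smult_le[of c U] by (simp add: monom_0)
        moreover have "degree (monom l k * P) \<le> degree U"
        proof -
          have "degree (monom l k * P) \<le> degree (monom l k) + degree P" by (rule degree_mult_le)
          also have "\<dots> \<le> k + degree P" using degree_monom_le[of l k] by simp
          finally show ?thesis using deg by (simp add: k_def)
        qed
        ultimately have "degree U1 \<le> degree U" unfolding U1_def by (rule degree_diff_le)
        moreover have "coeff U1 (degree U) = 0"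
          using deg by (simp add: U1_def coeff_monom_mult k_def) (simp add: defs mult.commute)
        ultimately show ?thesis by (metis leading_coeff_0_iff le_neq_implies_less)
      qed
      then have "poly V1 a + poly (pderiv U1) a * b = 0"
        using False by (intro less.hyps UV1 U1) auto
      moreover have "poly V1 a + poly (pderiv U1) a * b =
          c * (poly V a + poly (pderiv U) a * b) - l * a ^ k * (poly Q a + poly (pderiv P) a * b)
          + (c' + poly (pderiv (monom c 0)) a * b) * poly U a
          - (l' * a ^ k + poly (pderiv (monom l k)) a * b) * poly P a"
        by (simp add: U1_def V1_def pderiv_diff pderiv_mult poly_monom algebra_simps)
      ultimately have "c * (poly V a + poly (pderiv U) a * b) = 0"
        using b less.prems(2) P(2) by simp
      then show ?thesis using P(3) by (simp add: defs)
    qed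
  qed
  then show ?thesis using derivation_graph_extended[OF B] by blast
qed

lemma derivation_graph_Union:
  assumes "\<C> \<noteq> {}" "subset.chain {B. derivation_graph B} \<C>"
  shows "derivation_graph (\<Union>\<C>)"
proof -
  have dg: "derivation_graph B" if "B \<in> \<C>" for B
    using assms(2) that by (auto simp: subset.chain_def)
  have common: "\<exists>B\<in>\<C>. p \<in> B \<and> q \<in> B" if "p \<in> \<Union>\<C>" "q \<in> \<Union>\<C>" for p q
  proof -
    from that obtain B B' where BB: "B \<in> \<C>" "p \<in> B" "B' \<in> \<C>" "q \<in> B'" by blast
    then have "B \<subseteq> B' \<or> B' \<subseteq> B" using assms(2) by (auto simp: subset_chain_def)
    with BB show ?thesis by blast
  qed
  show ?thesis
    unfolding derivation_graph_def
  proof (intro conjI allI impI)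
    show "(1, 0) \<in> \<Union>\<C>" using assms(1) dg by (auto simp: derivation_graph_def)
  next
    fix a a' b b' assume "(a, a') \<in> \<Union>\<C>" "(b, b') \<in> \<Union>\<C>"
    with common obtain B where "B \<in> \<C>" "(a, a') \<in> B" "(b, b') \<in> B" by blast
    then show "(a - b, a' - b') \<in> \<Union>\<C>" "(a * b, a * b' + a' * b) \<in> \<Union>\<C>"
      using dg derivation_graph_diff derivation_graph_mult by blast+
  next
    fix a' assume "(0, a') \<in> \<Union>\<C>"
    then show "a' = 0" using dg by (auto simp: derivation_graph_def)
  qed
qed

text \<open>Zorn's lemma. In a maximal graph every real occurs as a first component, since otherwise the graph
  could be enlarged: with an arbitrary value at a transcendental element, and with the value forced
  by a minimal relation at an algebraic one.\<close>

lemma derivation_graph_extends_to_total: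
  assumes "derivation_graph B"
  shows "\<exists>M. derivation_graph M \<and> B \<subseteq> M \<and> fst ` M = UNIV"
proof -
  let ?A = "{M. derivation_graph M \<and> B \<subseteq> M}"
  have "\<exists>M\<in>?A. \<forall>X\<in>?A. M \<subseteq> X \<longrightarrow> X = M"
  proof (rule subset_Zorn_nonempty)
    show "?A \<noteq> {}" using assms by auto
  next
    fix \<C> assume C: "\<C> \<noteq> {}" "subset.chain ?A \<C>"
    then have "subset.chain {B. derivation_graph B} \<C>" by (auto simp: subset_chain_def)
    then have "derivation_graph (\<Union>\<C>)" by (rule derivation_graph_Union[OF C(1)])
    moreover have "B \<subseteq> \<Union>\<C>"
    proof -
      obtain X where "X \<in> \<C>" using C(1) by blast
      moreover from this have "B \<subseteq> X" using C(2) unfolding subset_chain_def by blast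
      ultimately show ?thesis by blast
    qed
    ultimately show "\<Union>\<C> \<in> ?A" by blast
  qed
  then obtain M where "M \<in> ?A" and max': "\<forall>X\<in>?A. M \<subseteq> X \<longrightarrow> X = M" ..
  then have M: "derivation_graph M" "B \<subseteq> M" by simp_all
  have max: "X = M" if "derivation_graph X" "M \<subseteq> X" for X
  proof -
    have "X \<in> ?A" using that M(2) by simp
    with max' that(2) show ?thesis by simp
  qed
  have "a \<in> fst ` M" for a
  proof -
    obtain b where b: "derivation_graph (extended_graph M a b)"
    proof (cases "\<exists>U V. (U, V) \<in> poly_graph M \<and> poly U a = 0 \<and> U \<noteq> 0")
      case True
      then show ?thesis using extended_graph_algebraic[OF M(1)] that by blast
    next
      case False
      then have "derivation_graph (extended_graph M a 0)"
        by (intro extended_graph_transcendental[OF M(1)]) blast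
      then show ?thesis by (rule that)
    qed
    then have "extended_graph M a b = M" by (rule max) (rule subset_extended_graph[OF M(1)])
    then have "(a, b) \<in> M" using generator_in_extended_graph[OF M(1), of a b] by simp
    then show ?thesis by (metis fst_conv imageI)
  qed
  with M show ?thesis by blast
qed

definition derivation :: "(real \<Rightarrow> real) \<Rightarrow> bool" where
  "derivation \<delta> \<longleftrightarrow> (\<forall>a b. \<delta> (a + b) = \<delta> a + \<delta> b) \<and> (\<forall>a b. \<delta> (a * b) = a * \<delta> b + \<delta> a * b)"

definition transcendental_over :: "real set \<Rightarrow> real \<Rightarrow> bool" where
  "transcendental_over A t \<longleftrightarrow> (\<forall>U. (\<forall>i. coeff U i \<in> A) \<longrightarrow> poly U t = 0 \<longrightarrow> U = 0)"

text \<open>The derivation by \<open>t\<close> on the ring \<open>A[t]\<close> of polynomials in a transcendental element, extended to all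
  of \<open>\<real>\<close>.\<close>

theorem derivation_exists:
  assumes "1 \<in> A" "\<And>a b. a \<in> A \<Longrightarrow> b \<in> A \<Longrightarrow> a - b \<in> A" "\<And>a b. a \<in> A \<Longrightarrow> b \<in> A \<Longrightarrow> a * b \<in> A"
    and t: "transcendental_over A t"
  shows "\<exists>\<delta>. derivation \<delta> \<and> (\<forall>a\<in>A. \<delta> a = 0) \<and> \<delta> t = 1"
proof -
  have A: "derivation_graph (A \<times> {0})"
    using assms by (auto simp: derivation_graph_def)
  have "derivation_graph (extended_graph (A \<times> {0}) t 1)"
  proof (rule extended_graph_transcendental[OF A])
    fix U V assume "(U, V) \<in> poly_graph (A \<times> {0})" "poly U t = 0"
    then show "U = 0" using t by (auto simp: transcendental_over_def poly_graph_def)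
  qed
  from derivation_graph_extends_to_total[OF this] obtain M where M: "derivation_graph M"
    "extended_graph (A \<times> {0}) t 1 \<subseteq> M" "fst ` M = UNIV" by blast
  have "\<exists>b. (a, b) \<in> M" for a
    using M(3) by (metis UNIV_I imageE prod.collapse)
  then obtain \<delta> where \<delta>: "\<And>a. (a, \<delta> a) \<in> M" by metis
  have eq: "\<delta> a = b" if "(a, b) \<in> M" for a b
    using derivation_graph_unique[OF M(1) \<delta> that] .
  show ?thesis
  proof (intro exI[of _ \<delta>] conjI allI ballI)
    show "derivation \<delta>"
      unfolding derivation_def
      by (intro conjI allI eq derivation_graph_add derivation_graph_mult \<delta> M)
    show "\<delta> a = 0" if "a \<in> A" for a
      using that subset_extended_graph[OF A] M(2) by (intro eq) auto
    show "\<delta> t = 1"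
      using generator_in_extended_graph[OF A] M(2) by (intro eq) auto
  qed
qed

section \<open>Values of the objective at Fritz John points\<close>

text \<open>The increasing stages that generate a subring; building the ring in stages makes its countability
  evident.\<close>

primrec ring_closure_step :: "real set \<Rightarrow> nat \<Rightarrow> real set" where
  "ring_closure_step C 0 = insert 1 C"
| "ring_closure_step C (Suc n) = ring_closure_step C n \<union>
     (\<lambda>(a, b). a - b) ` (ring_closure_step C n \<times> ring_closure_step C n) \<union>
     (\<lambda>(a, b). a * b) ` (ring_closure_step C n \<times> ring_closure_step C n)"

lemma countable_subring_exists:
  assumes "countable C"
  shows "\<exists>A. countable A \<and> C \<subseteq> A \<and> (1::real) \<in> A \<and>
     (\<forall>a\<in>A. \<forall>b\<in>A. a - b \<in> A \<and> a * b \<in> A)"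
proof (intro exI[of _ "\<Union>n. ring_closure_step C n"] conjI ballI)
  have "countable (ring_closure_step C n)" for n
    using assms by (induction n) simp_all
  then show "countable (\<Union>n. ring_closure_step C n)" by simp
  show "C \<subseteq> (\<Union>n. ring_closure_step C n)" "1 \<in> (\<Union>n. ring_closure_step C n)"
    by (auto intro!: exI[of _ 0])
next
  fix a b assume "a \<in> (\<Union>n. ring_closure_step C n)" "b \<in> (\<Union>n. ring_closure_step C n)"
  then obtain m n where mn: "a \<in> ring_closure_step C m" "b \<in> ring_closure_step C n" by blast
  have mono: "ring_closure_step C i \<subseteq> ring_closure_step C j" if "i \<le> j" for i j
    by (rule lift_Suc_mono_le[OF _ that]) auto
  have ab: "a \<in> ring_closure_step C (max m n)" "b \<in> ring_closure_step C (max m n)"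
    using mn mono[of m "max m n"] mono[of n "max m n"] by auto
  let ?S = "ring_closure_step C (max m n)"
  have "a - b \<in> (\<lambda>(a, b). a - b) ` (?S \<times> ?S)" "a * b \<in> (\<lambda>(a, b). a * b) ` (?S \<times> ?S)"
    using ab by (auto intro!: image_eqI[of _ _ "(a, b)"])
  then have "a - b \<in> ring_closure_step C (Suc (max m n))" "a * b \<in> ring_closure_step C (Suc (max m n))"
    by simp_all
  then show "a - b \<in> (\<Union>n. ring_closure_step C n)" "a * b \<in> (\<Union>n. ring_closure_step C n)" by blast+
qed

lemma countable_not_transcendental:
  assumes "countable A"
  shows "countable {t. \<not> transcendental_over A t}"
proof -
  let ?P = "{U. (\<forall>i. coeff U i \<in> A) \<and> U \<noteq> 0}"
  have "U \<in> Poly ` lists A" if "U \<in> ?P" for U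
  proof
    show "U = Poly (coeffs U)" by simp
    show "coeffs U \<in> lists A" using that by (auto simp: coeffs_def)
  qed
  then have "?P \<subseteq> Poly ` lists A" by blast
  then have "countable ?P"
    by (rule countable_subset) (intro countable_image countable_lists assms)
  then have "countable (\<Union>U\<in>?P. {t. poly U t = 0})"
    by (intro countable_UN) (auto intro: countable_finite poly_roots_finite)
  moreover have "{t. \<not> transcendental_over A t} \<subseteq> (\<Union>U\<in>?P. {t. poly U t = 0})"
    by (auto simp: transcendental_over_def)
  ultimately show ?thesis by (rule countable_subset[rotated])
qed

lemma derivation_zero: "derivation \<delta> \<Longrightarrow> \<delta> 0 = 0"
  unfolding derivation_def by (metis add_cancel_right_right)

lemma derivation_one: "derivation \<delta> \<Longrightarrow> \<delta> 1 = 0"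
  unfolding derivation_def by (metis add_cancel_right_right mult_1 mult.right_neutral)

lemma derivation_sum: "derivation \<delta> \<Longrightarrow> \<delta> (\<Sum>i\<in>I. a i) = (\<Sum>i\<in>I. \<delta> (a i))"
  by (induction I rule: infinite_finite_induct) (auto simp: derivation_zero, auto simp: derivation_def)

lemma derivation_power: "derivation \<delta> \<Longrightarrow> \<delta> (a ^ n) = real n * a ^ (n - 1) * \<delta> a"
proof (induction n)
  case (Suc n)
  then have "\<delta> (a ^ Suc n) = a * (real n * a ^ (n - 1) * \<delta> a) + \<delta> a * a ^ n"
    by (simp add: derivation_def)
  then show ?case by (cases n) (simp_all add: algebra_simps)
qed (simp add: derivation_one)

lemma derivation_prod:
  assumes "derivation \<delta>" "finite I"
  shows "\<delta> (\<Prod>i\<in>I. a i) = (\<Sum>i\<in>I. \<delta> (a i) * (\<Prod>j\<in>I - {i}. a j))"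
  using assms(2)
proof (induction I rule: finite_induct)
  case (insert k I)
  have "\<delta> (\<Prod>i\<in>insert k I. a i) = a k * \<delta> (\<Prod>i\<in>I. a i) + \<delta> (a k) * (\<Prod>i\<in>I. a i)"
    using insert assms(1) by (simp add: derivation_def)
  also have "a k * \<delta> (\<Prod>i\<in>I. a i) = (\<Sum>i\<in>I. \<delta> (a i) * (\<Prod>j\<in>insert k I - {i}. a j))"
    unfolding insert.IH sum_distrib_left
  proof (rule sum.cong)
    fix i assume "i \<in> I"
    then have "insert k I - {i} = insert k (I - {i})" using insert by auto
    then show "a k * (\<delta> (a i) * (\<Prod>j\<in>I - {i}. a j)) = \<delta> (a i) * (\<Prod>j\<in>insert k I - {i}. a j)"
      using insert by simp
  qed simp
  also have "(\<Prod>i\<in>I. a i) = (\<Prod>j\<in>insert k I - {k}. a j)" using insert by simp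
  finally show ?case using insert by (simp add: add.commute)
qed (use assms in \<open>simp add: derivation_one\<close>)

text \<open>The chain rule for abstract derivations: a derivation that kills the coefficients of \<open>p\<close> treats \<open>p\<close> as
  the gradient does.\<close>

lemma derivation_mpoly_eval:
  assumes \<delta>: "derivation \<delta>" and coeffs: "\<And>a. \<delta> (Poly_Mapping.lookup p a) = 0"
  shows "\<delta> (mpoly_eval p x) = (\<Sum>v\<in>UNIV. mpoly_eval (mpoly_pderiv v p) x * \<delta> (x $ v))"
proof -
  have "\<delta> (mpoly_eval p x) =
     (\<Sum>a\<in>Poly_Mapping.keys p. Poly_Mapping.lookup p a * \<delta> (monom_eval a x))"
    unfolding mpoly_eval_def derivation_sum[OF \<delta>]
    using \<delta> coeffs by (simp add: derivation_def)
  also have "\<dots> = (\<Sum>a\<in>Poly_Mapping.keys p. \<Sum>v\<in>UNIV. Poly_Mapping.lookup p a *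
     (real (Poly_Mapping.lookup a v) * (x $ v) ^ (Poly_Mapping.lookup a v - 1) *
     (\<Prod>u\<in>UNIV - {v}. (x $ u) ^ Poly_Mapping.lookup a u)) * \<delta> (x $ v))"
    unfolding monom_eval_def derivation_prod[OF \<delta> finite] derivation_power[OF \<delta>] sum_distrib_left
    by (simp only: mult_ac)
  also have "\<dots> = (\<Sum>v\<in>UNIV. mpoly_eval (mpoly_pderiv v p) x * \<delta> (x $ v))"
    unfolding mpoly_eval_pderiv sum_distrib_right by (rule sum.swap)
  finally show ?thesis .
qed

lemma join_vec_cases:
  fixes z :: "real^('n::finite + 'k::finite)"
  obtains x l where "z = join_vec x l"
proof
  show "z = join_vec (\<chi> i. z $ Inl i) (\<chi> k. z $ Inr k)"
    by (auto simp: join_vec_def vec_eq_iff split: sum.split)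
qed

lemma join_vec_Inr [simp]: "join_vec x l $ Inr k = l $ k"
  by (simp add: join_vec_def)

lemma mpoly_eval_lam [simp]: "mpoly_eval (lam k) (join_vec x l) = l $ k"
  by (simp add: lam_def)

lemma real_zeros_h_FJ_iff:
  fixes f :: "'n::finite mpoly" and g :: "'m::finite \<Rightarrow> 'n mpoly"
  shows "join_vec x l \<in> real_zeros (h_FJ f g) \<longleftrightarrow>
    (\<forall>i. l $ None * mpoly_eval (mpoly_pderiv i f) x =
        (\<Sum>j\<in>UNIV. l $ Some j * mpoly_eval (mpoly_pderiv i (g j)) x)) \<and>
    (\<forall>j. l $ Some j * mpoly_eval (g j) x = 0) \<and> (\<Sum>k\<in>UNIV. (l $ k)\<^sup>2) = 1"
proof -
  have all_sum: "(\<forall>r. P r) \<longleftrightarrow> (\<forall>i. P (Inl i)) \<and> (\<forall>j. P (Inr (Inl j))) \<and> P (Inr (Inr ()))"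
    for P :: "'n + 'm + unit \<Rightarrow> bool"
    by (metis (full_types) old.sum.exhaust old.unit.exhaust)
  show ?thesis
    unfolding real_zeros_def mem_Collect_eq all_sum by (auto simp: h_FJ_def)
qed

text \<open>The two equations for \<open>\<mu>\<close> belong to the two blocks of rows of the critical matrix, so \<open>\<mu>\<close> lies in its
  kernel.\<close>

lemma critical_point_if_relation:
  fixes g :: "'m::finite \<Rightarrow> 'n::finite mpoly"
  assumes "\<mu> \<noteq> 0" "\<And>i. (\<Sum>j\<in>UNIV. \<mu> $ j * mpoly_eval (mpoly_pderiv i (g j)) x) = 0"
    "\<And>j. \<mu> $ j * mpoly_eval (g j) x = 0"
  shows "x \<in> critical_points g"
proof -
  have "(critical_matrix g x *v \<mu>) $ r = 0" for r
  proof (cases r)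
    case (Inl i)
    then show ?thesis
      using assms(2)[of i] by (simp add: matrix_vector_mult_def critical_matrix_def mult.commute)
  next
    case (Inr k)
    have "(\<Sum>j\<in>UNIV. (if k = j then mpoly_eval (g j) x else 0) * \<mu> $ j) =
      (\<Sum>j\<in>UNIV. if k = j then mpoly_eval (g j) x * \<mu> $ j else 0)"
      by (rule sum.cong) auto
    then show ?thesis
      using assms(3)[of k] Inr by (simp add: matrix_vector_mult_def critical_matrix_def mult.commute)
  qed
  then have "critical_matrix g x *v \<mu> = critical_matrix g x *v 0" by (simp add: vec_eq_iff)
  with assms(1) have "\<not> inj ((*v) (critical_matrix g x))" by (metis injD)
  then have "rank (critical_matrix g x) \<noteq> CARD('m)" by (simp add: full_rank_injective)
  moreover have "rank (critical_matrix g x) \<le> CARD('m)"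
    using rank_bound[of "critical_matrix g x"] by simp
  ultimately show ?thesis by (simp add: critical_points_def)
qed

lemma countable_coefficients: "countable (range (Poly_Mapping.lookup p))"
proof (rule countable_subset)
  show "range (Poly_Mapping.lookup p) \<subseteq> insert 0 (Poly_Mapping.lookup p ` Poly_Mapping.keys p)"
    by (auto simp: in_keys_iff)
qed (simp add: countable_finite)

text \<open>An algebraic substitute for Sard's theorem. Let \<open>A\<close> be the countable ring generated by the
  coefficients, and let \<open>x\<close> satisfy the multiplier equations with \<open>t = f x\<close> transcendental over \<open>A\<close>.
  Apply a derivation \<open>\<delta>\<close> of \<open>\<real>\<close> that kills \<open>A\<close> and has \<open>\<delta> t = 1\<close>; the vector of the \<open>\<delta> (x $ i)\<close>
  plays the role of a tangent vector along which \<open>f\<close> changes. If \<open>\<lambda>\<^sub>j\<close> is nonzero then \<open>g\<^sub>j x = 0\<close>,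
  so \<open>\<delta> (g\<^sub>j x) = 0\<close>. Pairing the gradient equation with that vector therefore
  leaves \<open>\<lambda>\<^sub>0 = 0\<close>, and then the remaining multipliers show that \<open>x\<close> is a critical point of \<open>g\<close>.
  The values that are not transcendental over \<open>A\<close> are countably many.\<close>

theorem countable_FJ_values:
  fixes f :: "'n::finite mpoly" and g :: "'m::finite \<Rightarrow> 'n mpoly"
  assumes "countable (mpoly_eval f ` (critical_points g \<inter> S))"
  shows "countable (mpoly_eval f ` {x \<in> S. \<exists>l. join_vec x l \<in> real_zeros (h_FJ f g)})"
proof -
  let ?C = "range (Poly_Mapping.lookup f) \<union> (\<Union>j. range (Poly_Mapping.lookup (g j)))"
  have "countable ?C"
    by (intro countable_Un countable_UN countable_coefficients) (simp add: countable_finite)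
  from countable_subring_exists[OF this] obtain A where A: "countable A" "?C \<subseteq> A" "1 \<in> A"
    "\<And>a b. a \<in> A \<Longrightarrow> b \<in> A \<Longrightarrow> a - b \<in> A" "\<And>a b. a \<in> A \<Longrightarrow> b \<in> A \<Longrightarrow> a * b \<in> A" by blast
  have "x \<in> critical_points g"
    if t: "transcendental_over A (mpoly_eval f x)" and z: "join_vec x l \<in> real_zeros (h_FJ f g)" for x l
  proof -
    from derivation_exists[OF A(3-5) t] obtain \<delta> where \<delta>: "derivation \<delta>"
      "\<And>a. a \<in> A \<Longrightarrow> \<delta> a = 0" "\<delta> (mpoly_eval f x) = 1" by blast
    have coeffs: "Poly_Mapping.lookup f a \<in> A" "Poly_Mapping.lookup (g j) a \<in> A" for a j
      using A(2) by blast+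
    have \<delta>f: "\<delta> (mpoly_eval f x) = (\<Sum>i\<in>UNIV. mpoly_eval (mpoly_pderiv i f) x * \<delta> (x $ i))"
      and \<delta>g: "\<delta> (mpoly_eval (g j) x) = (\<Sum>i\<in>UNIV. mpoly_eval (mpoly_pderiv i (g j)) x * \<delta> (x $ i))" for j
      by (intro derivation_mpoly_eval \<delta> coeffs)+
    from z have h: "\<And>i. l $ None * mpoly_eval (mpoly_pderiv i f) x =
        (\<Sum>j\<in>UNIV. l $ Some j * mpoly_eval (mpoly_pderiv i (g j)) x)"
      "\<And>j. l $ Some j * mpoly_eval (g j) x = 0" "(\<Sum>k\<in>UNIV. (l $ k)\<^sup>2) = 1"
      by (auto simp: real_zeros_h_FJ_iff)
    have "l $ Some j * \<delta> (mpoly_eval (g j) x) = 0" for j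
      using h(2)[of j] derivation_zero[OF \<delta>(1)] by auto
    then have "0 = (\<Sum>j\<in>UNIV. l $ Some j * \<delta> (mpoly_eval (g j) x))" by (simp only: sum.neutral_const)
    also have "\<dots> = (\<Sum>i\<in>UNIV. (\<Sum>j\<in>UNIV. l $ Some j * mpoly_eval (mpoly_pderiv i (g j)) x) * \<delta> (x $ i))"
      unfolding \<delta>g sum_distrib_left sum_distrib_right by (subst sum.swap) (simp add: mult.assoc)
    also have "\<dots> = l $ None * \<delta> (mpoly_eval f x)"
      unfolding h(1)[symmetric] \<delta>f sum_distrib_left by (simp add: mult.assoc)
    finally have None: "l $ None = 0" using \<delta>(3) by simp
    define \<mu> where "\<mu> = (\<chi> j. l $ Some j)"
    have "\<mu> \<noteq> 0"
    proof
      assume "\<mu> = 0"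
      then have "l $ Some j = 0" for j by (simp add: \<mu>_def vec_eq_iff)
      with None have "l $ k = 0" for k by (cases k) auto
      then show False using h(3) by simp
    qed
    then show "x \<in> critical_points g"
      by (rule critical_point_if_relation) (use h None in \<open>auto simp: \<mu>_def simp flip: h(1)\<close>)
  qed
  then have "mpoly_eval f ` {x \<in> S. \<exists>l. join_vec x l \<in> real_zeros (h_FJ f g)} \<subseteq>
     {t. \<not> transcendental_over A t} \<union> mpoly_eval f ` (critical_points g \<inter> S)" by blast
  then show ?thesis
    by (rule countable_subset) (intro countable_Un countable_not_transcendental A(1) assms)
qed

section \<open>Sums of squares on the Fritz John variety\<close>

lemma mpolys_upto_prod:
  assumes "\<And>i. i \<in> I \<Longrightarrow> p i \<in> mpolys_upto k"
  shows "(\<Prod>i\<in>I. p i) \<in> mpolys_upto (card I * k)"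
  using assms by (induction I rule: infinite_finite_induct) (auto intro: mpolys_upto_mult)

text \<open>Lagrange interpolation in one variable, composed with \<open>F\<close>.\<close>

lemma interpolate_on_values:
  fixes F :: "'v::finite mpoly" and y :: "real \<Rightarrow> real"
  assumes "finite V" "F \<in> mpolys_upto d"
  shows "\<exists>p \<in> mpolys_upto (d * (card V - 1)). \<forall>z. mpoly_eval F z \<in> V \<longrightarrow> mpoly_eval p z = y (mpoly_eval F z)"
proof
  let ?L = "\<lambda>t. \<Prod>s\<in>V - {t}. F - Poly_Mapping.single 0 s"
  let ?p = "\<Sum>t\<in>V. Poly_Mapping.single 0 (y t / (\<Prod>s\<in>V - {t}. t - s)) * ?L t"
  show "?p \<in> mpolys_upto (d * (card V - 1))"
  proof (rule mpolys_upto_sum)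
    fix t assume "t \<in> V"
    have "Poly_Mapping.single 0 (y t / (\<Prod>s\<in>V - {t}. t - s)) * ?L t \<in> mpolys_upto (0 + card (V - {t}) * d)"
      by (intro mpolys_upto_mult mpolys_upto_prod mpolys_upto_diff mpolys_upto_single assms)
        (auto simp: monom_degree_def)
    then show "Poly_Mapping.single 0 (y t / (\<Prod>s\<in>V - {t}. t - s)) * ?L t \<in> mpolys_upto (d * (card V - 1))"
      using \<open>t \<in> V\<close> by (simp add: mult.commute)
  qed
  show "\<forall>z. mpoly_eval F z \<in> V \<longrightarrow> mpoly_eval ?p z = y (mpoly_eval F z)"
  proof (intro allI impI)
    fix z assume z: "mpoly_eval F z \<in> V" (is "?u \<in> V")
    have "mpoly_eval ?p z = (\<Sum>t\<in>V. y t / (\<Prod>s\<in>V - {t}. t - s) * (\<Prod>s\<in>V - {t}. ?u - s))"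
      by simp
    also have "\<dots> = (\<Sum>t\<in>V. if t = ?u then y ?u else 0)"
    proof (rule sum.cong)
      fix t assume "t \<in> V"
      show "y t / (\<Prod>s\<in>V - {t}. t - s) * (\<Prod>s\<in>V - {t}. ?u - s) = (if t = ?u then y ?u else 0)"
      proof (cases "t = ?u")
        case True
        moreover have "(\<Prod>s\<in>V - {t}. t - s) \<noteq> 0" using assms(1) by auto
        ultimately show ?thesis by simp
      next
        case False
        then have "(\<Prod>s\<in>V - {t}. ?u - s) = 0"
          using z assms(1) by (intro prod_zero) auto
        with False show ?thesis by simp
      qed
    qed simp
    also have "\<dots> = y ?u" using z assms(1) by simp
    finally show "mpoly_eval ?p z = y ?u" .
  qed
qed

lemma h_FJ_degree:
  fixes f :: "'n::finite mpoly" and g :: "'m::finite \<Rightarrow> 'n mpoly"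
  assumes "d \<ge> 1" "f \<in> mpolys_upto d" "\<And>j. g j \<in> mpolys_upto d"
  shows "h_FJ f g r \<in> mpolys_upto (d + 1)"
proof -
  have lam: "lam k \<in> mpolys_upto 1" for k :: "'m option"
    unfolding lam_def by (rule mpolys_upto_var) simp
  have pderiv: "mpoly_pderiv i p \<in> mpolys_upto d" if "p \<in> mpolys_upto d" for i and p :: "'n mpoly"
    using mpolys_upto_pderiv[OF that] by (rule mpolys_upto_mono) simp
  have prod: "lam k * extend_mpoly p \<in> mpolys_upto (d + 1)" if "p \<in> mpolys_upto d"
    for k :: "'m option" and p :: "'n mpoly"
    using mpolys_upto_mult[OF lam mpolys_upto_extend[OF that]] by (simp add: add.commute)
  have "(\<Sum>k\<in>UNIV. (lam k :: ('n + 'm option) mpoly)\<^sup>2) \<in> mpolys_upto (2 * 1)"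
    by (intro mpolys_upto_sum mpolys_upto_power lam)
  then have "(\<Sum>k\<in>UNIV. (lam k :: ('n + 'm option) mpoly)\<^sup>2) \<in> mpolys_upto (d + 1)"
    by (rule mpolys_upto_mono) (use assms(1) in simp)
  then show ?thesis
    by (auto simp: h_FJ_def split: sum.split
        intro!: mpolys_upto_diff mpolys_upto_sum prod[simplified] pderiv assms)
qed

text \<open>The inequalities \<open>g\<^sub>j \<ge> 0\<close> are turned into equations \<open>g\<^sub>j = y\<^sub>j\<^sup>2\<close> with one slack variable each, so that
  the relevant set is the projection of the zero set of a single nonnegative polynomial.\<close>

definition FJ_square_sum :: "'n::finite mpoly \<Rightarrow> ('m::finite \<Rightarrow> 'n mpoly) \<Rightarrow> (('n + 'm option) + 'm) mpoly" where
  "FJ_square_sum f g = (\<Sum>r\<in>UNIV. (extend_mpoly (h_FJ f g r))\<^sup>2) +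
     (\<Sum>j\<in>UNIV. (extend_mpoly (extend_mpoly (g j)) - (mpoly_var (Inr j))\<^sup>2)\<^sup>2)"

lemma FJ_square_sum_eval:
  "mpoly_eval (FJ_square_sum f g) (join_vec (join_vec x l) y) =
     (\<Sum>r\<in>UNIV. (mpoly_eval (h_FJ f g r) (join_vec x l))\<^sup>2) +
     (\<Sum>j\<in>UNIV. (mpoly_eval (g j) x - (y $ j)\<^sup>2)\<^sup>2)"
  by (simp add: FJ_square_sum_def)

lemma FJ_square_sum_nonneg: "0 \<le> mpoly_eval (FJ_square_sum f g) z"
  by (simp add: FJ_square_sum_def sum_nonneg)

lemma FJ_square_sum_degree:
  fixes f :: "'n::finite mpoly" and g :: "'m::finite \<Rightarrow> 'n mpoly"
  assumes "d \<ge> 1" "f \<in> mpolys_upto d" "\<And>j. g j \<in> mpolys_upto d"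
  shows "FJ_square_sum f g \<in> mpolys_upto (2 * (d + 1))"
proof -
  have "(mpoly_var (Inr j) :: (('n + 'm option) + 'm) mpoly)\<^sup>2 \<in> mpolys_upto (2 * 1)" for j
    by (intro mpolys_upto_power mpolys_upto_var) simp
  then have var: "(mpoly_var (Inr j) :: (('n + 'm option) + 'm) mpoly)\<^sup>2 \<in> mpolys_upto (d + 1)" for j
    by (rule mpolys_upto_mono) (use assms(1) in simp)
  have g: "g j \<in> mpolys_upto (d + 1)" for j using assms(3) by (rule mpolys_upto_mono) simp
  show ?thesis
    unfolding FJ_square_sum_def
    by (intro mpolys_upto_add mpolys_upto_sum mpolys_upto_power mpolys_upto_diff
        mpolys_upto_extend h_FJ_degree assms var g)
qed

lemma FJ_square_sum_values:
  fixes f :: "'n::finite mpoly" and g :: "'m::finite \<Rightarrow> 'n mpoly"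
  shows "mpoly_eval (extend_mpoly (extend_mpoly f)) ` {z. mpoly_eval (FJ_square_sum f g) z = 0} =
     mpoly_eval f ` {x \<in> basic_closed_set g. \<exists>l. join_vec x l \<in> real_zeros (h_FJ f g)}"
proof -
  have zero_iff: "mpoly_eval (FJ_square_sum f g) (join_vec (join_vec x l) y) = 0 \<longleftrightarrow>
     join_vec x l \<in> real_zeros (h_FJ f g) \<and> (\<forall>j. mpoly_eval (g j) x = (y $ j)\<^sup>2)" for x l y
    unfolding FJ_square_sum_eval real_zeros_def
    by (subst add_nonneg_eq_0_iff) (simp_all add: sum_nonneg sum_nonneg_eq_0_iff)
  show ?thesis
  proof (intro subset_antisym subsetI)
    fix t assume "t \<in> mpoly_eval (extend_mpoly (extend_mpoly f)) ` {z. mpoly_eval (FJ_square_sum f g) z = 0}"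
    then obtain z where z: "t = mpoly_eval (extend_mpoly (extend_mpoly f)) z"
      "mpoly_eval (FJ_square_sum f g) z = 0" by blast
    obtain u y where u: "z = join_vec u y" by (rule join_vec_cases)
    obtain x l where "u = join_vec x l" by (rule join_vec_cases)
    with z u have "t = mpoly_eval f x" "join_vec x l \<in> real_zeros (h_FJ f g)"
      "\<forall>j. mpoly_eval (g j) x = (y $ j)\<^sup>2" by (simp_all add: zero_iff)
    then show "t \<in> mpoly_eval f ` {x \<in> basic_closed_set g. \<exists>l. join_vec x l \<in> real_zeros (h_FJ f g)}"
      by (auto simp: basic_closed_set_def)
  next
    fix t assume "t \<in> mpoly_eval f ` {x \<in> basic_closed_set g. \<exists>l. join_vec x l \<in> real_zeros (h_FJ f g)}"
    then obtain x l where x: "t = mpoly_eval f x" "x \<in> basic_closed_set g"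
      "join_vec x l \<in> real_zeros (h_FJ f g)" by blast
    let ?z = "join_vec (join_vec x l) (\<chi> j. sqrt (mpoly_eval (g j) x))"
    have "mpoly_eval (FJ_square_sum f g) ?z = 0"
      using x by (simp add: zero_iff basic_closed_set_def)
    moreover have "t = mpoly_eval (extend_mpoly (extend_mpoly f)) ?z" using x by simp
    ultimately show "t \<in> mpoly_eval (extend_mpoly (extend_mpoly f)) ` {z. mpoly_eval (FJ_square_sum f g) z = 0}"
      by blast
  qed
qed

text \<open>The left-hand side is the bound of \<open>card_values_on_zero_set_le\<close> for a polynomial of degree
  \<open>2 * (d + 1)\<close> in \<open>n\<close> variables, \<open>m + 1\<close> multipliers and \<open>m\<close> slack variables. The perturbation by
  powers of degree higher than that of the polynomial has raised the base from \<open>2 * d + 1\<close> to \<open>2 * d + 3\<close>;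
  the larger exponent of the right-hand side pays for it. For each \<open>x\<close> variable the right-hand side
  has two factors \<open>2 * d + 1\<close>, and three for each index of a constraint.\<close>

lemma perturbation_bound_le_c_bound:
  assumes "d \<ge> 1"
  shows "(2 * (d + 1) + 1) ^ (n + (m + 1) + m) \<le> c_bound (n + m + 1) (d + 1) (n + 2 * m + 1)"
proof -
  obtain e where "d = e + 1" using assms by (metis le_add_diff_inverse2)
  then have 1: "2 * d + 3 \<le> (2 * d + 1) ^ 2"
    and 2: "(2 * d + 3) ^ 2 \<le> (2 * d + 1) ^ 3"
    and 3: "2 * d + 3 \<le> (d + 1) * (2 * d + 1)"
    by (simp_all add: power2_eq_square power3_eq_cube algebra_simps)
  have exponent: "n + (m + 1) + m = n + 2 * m + 1" and base: "2 * (d + 1) + 1 = 2 * d + 3" by simp_all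
  have "(2 * (d + 1) + 1) ^ (n + (m + 1) + m) = (2 * d + 3) ^ n * ((2 * d + 3) ^ 2) ^ m * (2 * d + 3)"
    unfolding exponent base by (simp only: power_add power_mult power_one_right)
  also have "\<dots> \<le> ((2 * d + 1) ^ 2) ^ n * ((2 * d + 1) ^ 3) ^ m * ((d + 1) * (2 * d + 1))"
    by (intro mult_le_mono power_mono 1 2 3) auto
  also have "\<dots> = (d + 1) * (2 * d + 1) ^ (2 * n + 3 * m + 1)"
    by (simp only: power_add power_mult power_one_right) (simp only: mult_ac)
  also have "2 * n + 3 * m + 1 = (n + m + 1) + (n + 2 * m + 1) - 1" by simp
  finally show ?thesis by (simp add: c_bound_def)
qed

lemma card_FJ_values_le:
  fixes f :: "'n::finite mpoly" and g :: "'m::finite \<Rightarrow> 'n mpoly"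
  assumes d: "d \<ge> 1" and "f \<in> mpolys_upto d" "\<And>j. g j \<in> mpolys_upto d"
    and crit: "countable (mpoly_eval f ` (critical_points g \<inter> basic_closed_set g))"
  defines "V \<equiv> mpoly_eval f ` {x \<in> basic_closed_set g. \<exists>l. join_vec x l \<in> real_zeros (h_FJ f g)}"
  shows "finite V \<and> card V \<le> c_bound (CARD('n) + CARD('m) + 1) (d + 1) (CARD('n) + 2 * CARD('m) + 1)"
proof (rule finite_if_finite_subsets_card_bdd)
  fix T assume T: "T \<subseteq> V" "finite T"
  have "card T \<le> (2 * (d + 1) + 1) ^ CARD(('n + 'm option) + 'm)"
  proof (rule card_values_on_zero_set_le)
    show "FJ_square_sum f g \<in> mpolys_upto (2 * (d + 1))" by (intro FJ_square_sum_degree assms)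
    show "countable (mpoly_eval (extend_mpoly (extend_mpoly f)) ` {z. mpoly_eval (FJ_square_sum f g) z = 0})"
      unfolding FJ_square_sum_values by (rule countable_FJ_values) (rule crit)
    show "T \<subseteq> mpoly_eval (extend_mpoly (extend_mpoly f)) ` {z. mpoly_eval (FJ_square_sum f g) z = 0}"
      using T(1) unfolding FJ_square_sum_values V_def .
  qed (use T FJ_square_sum_nonneg in auto)
  also have "CARD(('n + 'm option) + 'm) = CARD('n) + (CARD('m) + 1) + CARD('m)" by simp
  finally show "card T \<le> c_bound (CARD('n) + CARD('m) + 1) (d + 1) (CARD('n) + 2 * CARD('m) + 1)"
    using perturbation_bound_le_c_bound[OF d] by (rule le_trans)
qed

theorem theorem2:
  fixes f :: "'n::finite mpoly" and g :: "'m::finite \<Rightarrow> 'n mpoly" and d w :: nat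
  assumes "d \<ge> 1"
    and "f \<in> mpolys_upto d"
    and "\<And>j. g j \<in> mpolys_upto d"
    and "\<And>x. x \<in> basic_closed_set g \<Longrightarrow> mpoly_eval f x \<ge> 0"
    and "finite (mpoly_eval f ` (critical_points g \<inter> basic_closed_set g))"
    and "w = d * (c_bound (CARD('n) + CARD('m) + 1) (d + 1) (CARD('n) + 2 * CARD('m) + 1) - 1)"
  shows "\<exists>q \<in> (sos_upto w :: ('n + 'm option) mpoly set).
    \<forall>z \<in> (\<lambda>(x, l). join_vec x l) ` (basic_closed_set g \<times> UNIV) \<inter> real_zeros (h_FJ f g).
      mpoly_eval (extend_mpoly f - q) z = 0"
proof -
  define V where "V = mpoly_eval f ` {x \<in> basic_closed_set g. \<exists>l. join_vec x l \<in> real_zeros (h_FJ f g)}"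
  have "finite V \<and> card V \<le> c_bound (CARD('n) + CARD('m) + 1) (d + 1) (CARD('n) + 2 * CARD('m) + 1)"
    unfolding V_def using assms(1-3) countable_finite[OF assms(5)] by (rule card_FJ_values_le)
  then have V: "finite V" "d * (card V - 1) \<le> w" unfolding assms(6) by (auto intro: diff_le_mono)
  have "(extend_mpoly f :: ('n + 'm option) mpoly) \<in> mpolys_upto d" using assms(2) by (rule mpolys_upto_extend)
  from interpolate_on_values[OF V(1) this, of sqrt] obtain p :: "('n + 'm option) mpoly"
    where p: "p \<in> mpolys_upto (d * (card V - 1))"
      "\<And>z. mpoly_eval (extend_mpoly f) z \<in> V \<Longrightarrow> mpoly_eval p z = sqrt (mpoly_eval (extend_mpoly f) z)"
    by blast
  have "p\<^sup>2 \<in> sos_upto w"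
    unfolding sos_upto_def mem_Collect_eq
    using mpolys_upto_mono[OF p(1) V(2)] by (intro exI[of _ "[p]"]) simp
  moreover have "mpoly_eval (extend_mpoly f - p\<^sup>2) z = 0"
    if z: "z \<in> (\<lambda>(x, l). join_vec x l) ` (basic_closed_set g \<times> UNIV) \<inter> real_zeros (h_FJ f g)" for z
  proof -
    from z obtain x l where x: "z = join_vec x l" "x \<in> basic_closed_set g"
      "join_vec x l \<in> real_zeros (h_FJ f g)" by auto
    then have "mpoly_eval f x \<in> V" unfolding V_def by blast
    with p(2)[of z] x have "mpoly_eval p z = sqrt (mpoly_eval f x)" by simp
    with assms(4)[OF x(2)] x show ?thesis by simp
  qed
  ultimately show ?thesis by blast
qed

end
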